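(* Let $u$ be a plurisubharmonic function near the origin $o\in\mathbb{C}^n$ and let $J\subseteq\mathcal{O}_{o}$ be a nonzero coherent ideal. Then $$c^{J}_{o}(u)\le\frac{c_{o}(u)}{c_{o}(\log|J|)}+c_{o}(u).$$
   Context: $\mathcal{O}_o$ is the ring of germs of holomorphic functions at $o$. Plurisubharmonic functions are not identically $-\infty$. For an ideal $J\subseteq\mathcal{O}_o$ (always finitely generated) with generators $f_1,\dots,f_s$, $|J|=\sum_j|f_j|$. The jumping number is $c_o^J(u)=\sup\{c\ge0:\ |J|^2e^{-2cu}\text{ is integrable near }o\}\in[0,+\infty]$, and $c_o(u)=c_o^{\mathcal{O}_o}(u)$ is the complex singularity exponent. Conventions: $a/(+\infty)=0$ for finite $a$, and the right-hand side is $+\infty$ when $c_o(u)=+\infty$. *)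

theory Defs
  imports "HOL-Analysis.Analysis"
begin

definition holomorphic_several :: "(complex ^ 'n \<Rightarrow> complex) \<Rightarrow> (complex ^ 'n) set \<Rightarrow> bool" where
  "holomorphic_several f U \<longleftrightarrow>
     (\<forall>z\<in>U. \<exists>D. (f has_derivative D) (at z) \<and> (\<forall>c v. D (c *s v) = c * D v))"

definition holomorphic_near_0 :: "(complex ^ 'n \<Rightarrow> complex) \<Rightarrow> bool" where
  "holomorphic_near_0 f \<longleftrightarrow> (\<exists>U. open U \<and> 0 \<in> U \<and> holomorphic_several f U)"

definition germ_eq :: "(complex ^ 'n \<Rightarrow> complex) \<Rightarrow> (complex ^ 'n \<Rightarrow> complex) \<Rightarrow> bool" where
  "germ_eq f g \<longleftrightarrow>
     holomorphic_near_0 f \<and> holomorphic_near_0 g \<and> eventually (\<lambda>z. f z = g z) (nhds 0)"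

lemma holomorphic_several_subset:
  "holomorphic_several f U \<Longrightarrow> V \<subseteq> U \<Longrightarrow> holomorphic_several f V"
  unfolding holomorphic_several_def by blast

lemma holomorphic_several_const: "holomorphic_several (\<lambda>_. c) U"
  unfolding holomorphic_several_def by (auto intro!: exI[of _ "\<lambda>_. 0"])

lemma holomorphic_several_add:
  assumes "holomorphic_several f U" "holomorphic_several g U"
  shows "holomorphic_several (\<lambda>z. f z + g z) U"
  unfolding holomorphic_several_def
proof
  fix z assume "z \<in> U"
  then obtain D E where "(f has_derivative D) (at z)" "\<forall>c v. D (c *s v) = c * D v"
    "(g has_derivative E) (at z)" "\<forall>c v. E (c *s v) = c * E v"
    using assms unfolding holomorphic_several_def by meson
  then show "\<exists>D. ((\<lambda>z. f z + g z) has_derivative D) (at z) \<and> (\<forall>c v. D (c *s v) = c * D v)"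
    by (intro exI[of _ "\<lambda>v. D v + E v"]) (auto intro!: derivative_intros simp: algebra_simps)
qed

lemma holomorphic_several_mult:
  assumes "holomorphic_several f U" "holomorphic_several g U"
  shows "holomorphic_several (\<lambda>z. f z * g z) U"
  unfolding holomorphic_several_def
proof
  fix z assume "z \<in> U"
  then obtain D E where "(f has_derivative D) (at z)" "\<forall>c v. D (c *s v) = c * D v"
    "(g has_derivative E) (at z)" "\<forall>c v. E (c *s v) = c * E v"
    using assms unfolding holomorphic_several_def by meson
  then show "\<exists>D. ((\<lambda>z. f z * g z) has_derivative D) (at z) \<and> (\<forall>c v. D (c *s v) = c * D v)"
    by (intro exI[of _ "\<lambda>v. f z * E v + D v * g z"])
       (use has_derivative_mult[of f D z UNIV g E] in \<open>auto simp: algebra_simps\<close>)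
qed

lemma holomorphic_near_0_const [simp]: "holomorphic_near_0 (\<lambda>_. c)"
  unfolding holomorphic_near_0_def using holomorphic_several_const open_UNIV by blast

lemma holomorphic_near_0_add:
  assumes "holomorphic_near_0 f" "holomorphic_near_0 g"
  shows "holomorphic_near_0 (\<lambda>z. f z + g z)"
proof -
  obtain U V where UV: "open U" "0 \<in> U" "holomorphic_several f U"
    "open V" "0 \<in> V" "holomorphic_several g V"
    using assms unfolding holomorphic_near_0_def by blast
  then have "holomorphic_several (\<lambda>z. f z + g z) (U \<inter> V)"
    by (intro holomorphic_several_add) (auto elim: holomorphic_several_subset)
  with UV show ?thesis unfolding holomorphic_near_0_def by (intro exI[of _ "U \<inter> V"]) auto
qed

lemma holomorphic_near_0_mult:
  assumes "holomorphic_near_0 f" "holomorphic_near_0 g"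
  shows "holomorphic_near_0 (\<lambda>z. f z * g z)"
proof -
  obtain U V where UV: "open U" "0 \<in> U" "holomorphic_several f U"
    "open V" "0 \<in> V" "holomorphic_several g V"
    using assms unfolding holomorphic_near_0_def by blast
  then have "holomorphic_several (\<lambda>z. f z * g z) (U \<inter> V)"
    by (intro holomorphic_several_mult) (auto elim: holomorphic_several_subset)
  with UV show ?thesis unfolding holomorphic_near_0_def by (intro exI[of _ "U \<inter> V"]) auto
qed

lemma holomorphic_near_0_uminus:
  "holomorphic_near_0 f \<Longrightarrow> holomorphic_near_0 (\<lambda>z. - f z)"
  using holomorphic_near_0_mult[OF holomorphic_near_0_const[of "-1"], of f] by simp

lemma part_equivp_germ_eq: "part_equivp (germ_eq :: (complex ^ 'n \<Rightarrow> complex) \<Rightarrow> _)"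
proof (rule part_equivpI)
  show "\<exists>f. germ_eq f (f :: complex ^ 'n \<Rightarrow> complex)"
    by (rule exI[of _ "\<lambda>_. 0"]) (simp add: germ_eq_def)
  show "symp (germ_eq :: (complex ^ 'n \<Rightarrow> complex) \<Rightarrow> _)"
    by (auto simp: symp_def germ_eq_def elim: eventually_mono)
  show "transp (germ_eq :: (complex ^ 'n \<Rightarrow> complex) \<Rightarrow> _)"
    by (auto simp: transp_def germ_eq_def elim: eventually_elim2)
qed

text \<open>The ring of germs at the origin: functions that are holomorphic near the origin, modulo
  equality near the origin. \<open>abs_germ f\<close> is the germ of \<open>f\<close>; it is meaningful only when
  \<open>f\<close> is holomorphic near the origin.\<close>

quotient_type (overloaded) 'n germ = "complex ^ ('n::finite) \<Rightarrow> complex" / partial: germ_eq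
  by (rule part_equivp_germ_eq)

instantiation germ :: (finite) comm_ring_1
begin

lift_definition zero_germ :: "'a germ" is "\<lambda>_. 0"
  by (simp add: germ_eq_def)

lift_definition one_germ :: "'a germ" is "\<lambda>_. 1"
  by (simp add: germ_eq_def)

lift_definition plus_germ :: "'a germ \<Rightarrow> 'a germ \<Rightarrow> 'a germ" is "\<lambda>f g z. f z + g z"
  by (auto simp: germ_eq_def intro: holomorphic_near_0_add elim: eventually_elim2)

lift_definition times_germ :: "'a germ \<Rightarrow> 'a germ \<Rightarrow> 'a germ" is "\<lambda>f g z. f z * g z"
  by (auto simp: germ_eq_def intro: holomorphic_near_0_mult elim: eventually_elim2)

lift_definition uminus_germ :: "'a germ \<Rightarrow> 'a germ" is "\<lambda>f z. - f z"
  by (auto simp: germ_eq_def intro: holomorphic_near_0_uminus elim: eventually_mono)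

definition minus_germ :: "'a germ \<Rightarrow> 'a germ \<Rightarrow> 'a germ" where
  "minus_germ a b = a + (- b)"

instance
proof
  fix a b c :: "'a germ"
  show "a * b * c = a * (b * c)"
    by transfer (auto simp: germ_eq_def mult.assoc intro!: holomorphic_near_0_mult)
  show "a * b = b * a"
    by transfer (auto simp: germ_eq_def mult.commute intro!: holomorphic_near_0_mult)
  show "1 * a = a"
    by transfer (auto simp: germ_eq_def)
  show "(a + b) * c = a * c + b * c"
    by transfer (auto simp: germ_eq_def algebra_simps
        intro!: holomorphic_near_0_mult holomorphic_near_0_add)
  show "a + b + c = a + (b + c)"
    by transfer (auto simp: germ_eq_def add.assoc intro!: holomorphic_near_0_add)
  show "a + b = b + a"
    by transfer (auto simp: germ_eq_def add.commute intro!: holomorphic_near_0_add)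
  show "0 + a = a"
    by transfer (auto simp: germ_eq_def)
  show "- a + a = 0"
    by transfer (auto simp: germ_eq_def intro!: holomorphic_near_0_add holomorphic_near_0_uminus)
  show "a - b = a + - b"
    by (rule minus_germ_def)
  show "(0::'a germ) \<noteq> 1"
  proof (transfer, rule notI)
    assume "germ_eq (\<lambda>_::complex^'a. 0) (\<lambda>_. 1)"
    then have "eventually (\<lambda>z::complex^'a. (0::complex) = 1) (nhds 0)"
      by (simp add: germ_eq_def)
    then show False using eventually_nhds_x_imp_x by fastforce
  qed
qed

end

text \<open>Ideals are the submodules of the ring regarded as a module over itself; an ideal is coherent
  when it is generated by finitely many germs.\<close>

definition germ_ideal :: "('n::finite) germ set \<Rightarrow> bool" where
  "germ_ideal J \<longleftrightarrow> module.subspace (*) J"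

definition generates_ideal :: "(complex ^ 'n \<Rightarrow> complex) set \<Rightarrow> ('n::finite) germ set \<Rightarrow> bool" where
  "generates_ideal F J \<longleftrightarrow>
     finite F \<and> (\<forall>f\<in>F. holomorphic_near_0 f) \<and> J = module.span (*) (abs_germ ` F)"

definition coherent_ideal :: "('n::finite) germ set \<Rightarrow> bool" where
  "coherent_ideal J \<longleftrightarrow> germ_ideal J \<and> (\<exists>F. generates_ideal F J)"

definition gen_abs :: "(complex ^ 'n \<Rightarrow> complex) set \<Rightarrow> complex ^ 'n \<Rightarrow> real" where
  "gen_abs F z = (\<Sum>f\<in>F. norm (f z))"

text \<open>The function \<open>|J|\<close> depends on the choice of generators. Two choices are comparable near the
  origin (lemma \<open>gen_abs_comparable\<close> below), so jumping numbers do not depend on it.\<close>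

definition ideal_abs :: "('n::finite) germ set \<Rightarrow> complex ^ 'n \<Rightarrow> real" where
  "ideal_abs J = gen_abs (SOME F. generates_ideal F J)"

definition log_ideal_abs :: "('n::finite) germ set \<Rightarrow> complex ^ 'n \<Rightarrow> ereal" where
  "log_ideal_abs J z = (if ideal_abs J z = 0 then -\<infinity> else ereal (ln (ideal_abs J z)))"

text \<open>The mean of \<open>u\<close> over the circle \<open>a + e\<^sup>i\<^sup>\<theta> b\<close>, as the integral of the positive part minus the
  integral of the negative part. For upper semicontinuous \<open>u < \<infinity>\<close> the first is finite, and the
  mean lies in \<open>[-\<infinity>, \<infinity>)\<close>. Note that \<open>e2ennreal\<close> sends negative numbers to \<open>0\<close>.\<close>

definition circle_mean :: "(complex ^ 'n \<Rightarrow> ereal) \<Rightarrow> complex ^ 'n \<Rightarrow> complex ^ 'n \<Rightarrow> ereal" where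
  "circle_mean u a b =
     (enn2ereal (\<integral>\<^sup>+\<theta>\<in>{0..2*pi}. e2ennreal (u (a + cis \<theta> *s b)) \<partial>lborel)
      - enn2ereal (\<integral>\<^sup>+\<theta>\<in>{0..2*pi}. e2ennreal (- u (a + cis \<theta> *s b)) \<partial>lborel)) / ereal (2*pi)"

definition plurisubharmonic_on :: "(complex ^ 'n \<Rightarrow> ereal) \<Rightarrow> (complex ^ 'n) set \<Rightarrow> bool" where
  "plurisubharmonic_on u U \<longleftrightarrow>
     (\<forall>z\<in>U. u z < \<infinity>) \<and>
     (\<forall>c::real. open {z\<in>U. u z < ereal c}) \<and>
     (\<forall>a b. (\<forall>\<zeta>. norm \<zeta> \<le> 1 \<longrightarrow> a + \<zeta> *s b \<in> U) \<longrightarrow> u a \<le> circle_mean u a b) \<and>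
     (\<exists>z\<in>U. u z \<noteq> -\<infinity>)"

text \<open>The neighbourhood is connected, so that \<open>u\<close> is not identically \<open>-\<infinity>\<close> near the origin.\<close>

definition plurisubharmonic_near_0 :: "(complex ^ 'n \<Rightarrow> ereal) \<Rightarrow> bool" where
  "plurisubharmonic_near_0 u \<longleftrightarrow>
     (\<exists>U. open U \<and> connected U \<and> 0 \<in> U \<and> plurisubharmonic_on u U)"

definition exp_ereal :: "ereal \<Rightarrow> ennreal" where
  "exp_ereal x = (case x of ereal r \<Rightarrow> ennreal (exp r) | PInfty \<Rightarrow> \<infinity> | MInfty \<Rightarrow> 0)"

definition integrable_near_0 :: "(complex ^ 'n \<Rightarrow> ennreal) \<Rightarrow> bool" where
  "integrable_near_0 g \<longleftrightarrow>
     (\<exists>U. open U \<and> 0 \<in> U \<and> (\<lambda>z. g z * indicator U z) \<in> borel_measurable lborel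
        \<and> (\<integral>\<^sup>+z\<in>U. g z \<partial>lborel) < \<infinity>)"

text \<open>Since \<open>0 * -\<infinity> = 0\<close> in \<open>ereal\<close>, the integrand for \<open>c = 0\<close> is \<open>|J|\<^sup>2\<close> everywhere. The value
  \<open>0 * \<infinity> = 0\<close> of the integrand for \<open>c > 0\<close> occurs only on the zero set of \<open>|J|\<close>, a null set
  near the origin if \<open>J \<noteq> {0}\<close>.\<close>

definition jumping_number :: "('n::finite) germ set \<Rightarrow> (complex ^ 'n \<Rightarrow> ereal) \<Rightarrow> ereal" where
  "jumping_number J u =
     Sup (ereal ` {c. 0 \<le> c \<and> integrable_near_0
       (\<lambda>z. ennreal ((ideal_abs J z)\<^sup>2) * exp_ereal (ereal (- 2 * c) * u z))})"

definition singularity_exponent :: "(complex ^ ('n::finite) \<Rightarrow> ereal) \<Rightarrow> ereal" where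
  "singularity_exponent u = jumping_number UNIV u"

interpretation germ: module "(*) :: ('n::finite) germ \<Rightarrow> 'n germ \<Rightarrow> 'n germ"
  by standard (simp_all add: algebra_simps)

lemma coherent_ideal_UNIV: "coherent_ideal (UNIV :: ('n::finite) germ set)"
proof -
  have 1: "abs_germ (\<lambda>_::complex^'n. 1) = 1" by (simp add: one_germ_def)
  have "x \<in> germ.span {1}" for x :: "'n germ"
    using germ.span_scale[OF germ.span_base[of 1 "{1}"], of x] by simp
  then have "generates_ideal {\<lambda>_. 1} (UNIV :: 'n germ set)"
    by (auto simp: generates_ideal_def 1)
  then show ?thesis by (auto simp: coherent_ideal_def germ_ideal_def)
qed

lemma holomorphic_near_0_isCont:
  assumes "holomorphic_near_0 f"
  shows "isCont f 0"
  using assms unfolding holomorphic_near_0_def holomorphic_several_def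
  by (blast intro: has_derivative_continuous)

lemma abs_germ_mult:
  "holomorphic_near_0 f \<Longrightarrow> holomorphic_near_0 g \<Longrightarrow>
     abs_germ f * abs_germ g = abs_germ (\<lambda>z. f z * g z)"
  by (simp add: times_germ.abs_eq germ_eq_def)

lemma abs_germ_eq:
  "holomorphic_near_0 f \<Longrightarrow> holomorphic_near_0 g \<Longrightarrow>
     abs_germ f = abs_germ g \<longleftrightarrow> eventually (\<lambda>z. f z = g z) (nhds 0)"
  using Quotient_rel[OF Quotient_germ, of f g] by (auto simp: germ_eq_def)

lemma ex_germ_rep: "\<exists>f. holomorphic_near_0 f \<and> abs_germ f = a"
proof (intro exI conjI)
  show "abs_germ (rep_germ a) = a" by (rule Quotient_abs_rep[OF Quotient_germ])
  have "germ_eq (rep_germ a) (rep_germ a)" by (rule Quotient_rep_reflp[OF Quotient_germ])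
  then show "holomorphic_near_0 (rep_germ a)" by (simp add: germ_eq_def)
qed

lemma gen_abs_nonneg: "0 \<le> gen_abs F z"
  by (simp add: gen_abs_def sum_nonneg)

lemma span_abs_germ_bound:
  assumes "finite F" "\<forall>f\<in>F. holomorphic_near_0 f"
    and "a \<in> germ.span (abs_germ ` F)"
  shows "\<forall>g. holomorphic_near_0 g \<longrightarrow> abs_germ g = a \<longrightarrow>
    (\<exists>C\<ge>0. eventually (\<lambda>z. norm (g z) \<le> C * gen_abs F z) (nhds 0))"
  using assms(3)
proof (induction rule: germ.span_induct_alt)
  case base
  show ?case
  proof (intro allI impI)
    fix g :: "complex^'a \<Rightarrow> complex" assume g: "holomorphic_near_0 g" "abs_germ g = 0"
    then have "eventually (\<lambda>z. g z = 0) (nhds 0)"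
      using abs_germ_eq[of g "\<lambda>_. 0"] by (simp add: zero_germ_def)
    then have "eventually (\<lambda>z. norm (g z) \<le> 0 * gen_abs F z) (nhds 0)"
      by eventually_elim simp
    then show "\<exists>C\<ge>0. eventually (\<lambda>z. norm (g z) \<le> C * gen_abs F z) (nhds 0)" by blast
  qed
next
  case (step c x y)
  show ?case
  proof (intro allI impI)
    fix g :: "complex^'a \<Rightarrow> complex" assume g: "holomorphic_near_0 g" "abs_germ g = c * x + y"
    obtain f where f: "f \<in> F" "x = abs_germ f" using step by auto
    with assms have hf: "holomorphic_near_0 f" by blast
    obtain h where h: "holomorphic_near_0 h" "abs_germ h = c" using ex_germ_rep by blast
    obtain k where k: "holomorphic_near_0 k" "abs_germ k = y" using ex_germ_rep by blast
    obtain C where C: "C \<ge> 0" "eventually (\<lambda>z. norm (k z) \<le> C * gen_abs F z) (nhds 0)"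
      using step k by blast
    note hm = holomorphic_near_0_mult[OF h(1) hf]
    have "abs_germ g = abs_germ (\<lambda>z. h z * f z + k z)"
      using g(2) hm k(1) abs_germ_mult[OF h(1) hf]
      unfolding f(2) h(2)[symmetric] k(2)[symmetric] by (simp add: plus_germ.abs_eq germ_eq_def)
    then have ev: "eventually (\<lambda>z. g z = h z * f z + k z) (nhds 0)"
      using abs_germ_eq[OF g(1) holomorphic_near_0_add[OF hm k(1)]] by simp
    have "(h \<longlongrightarrow> h 0) (nhds 0)"
      using holomorphic_near_0_isCont[OF h(1)] by (simp add: continuous_at_imp_continuous_at_within
          isCont_def tendsto_nhds_iff)
    then have "eventually (\<lambda>z. dist (h z) (h 0) < 1) (nhds 0)"
      by (rule tendstoD) simp
    then have "eventually (\<lambda>z. norm (g z) \<le> (norm (h 0) + 1 + C) * gen_abs F z) (nhds 0)"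
      using ev C(2)
    proof eventually_elim
      case (elim z)
      have "norm (h z) \<le> norm (h 0) + 1"
        using elim(1) norm_triangle_sub[of "h z" "h 0"] by (simp add: dist_norm)
      moreover have "norm (f z) \<le> gen_abs F z"
        unfolding gen_abs_def using f(1) assms(1) by (intro member_le_sum) auto
      ultimately have "norm (h z * f z) \<le> (norm (h 0) + 1) * gen_abs F z"
        unfolding norm_mult by (intro mult_mono) auto
      with elim show ?case
        using norm_triangle_ineq[of "h z * f z" "k z"] by (simp add: algebra_simps)
    qed
    with C(1) show "\<exists>C\<ge>0. eventually (\<lambda>z. norm (g z) \<le> C * gen_abs F z) (nhds 0)"
      by (intro exI[of _ "norm (h 0) + 1 + C"]) auto
  qed
qed

lemma gen_abs_comparable:
  assumes "generates_ideal F J" "generates_ideal G J"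
  shows "\<exists>C>0. eventually (\<lambda>z. gen_abs G z \<le> C * gen_abs F z) (nhds 0)"
proof -
  have F: "finite F" "\<forall>f\<in>F. holomorphic_near_0 f" "J = germ.span (abs_germ ` F)"
    and G: "finite G" "\<forall>f\<in>G. holomorphic_near_0 f" "J = germ.span (abs_germ ` G)"
    using assms by (auto simp: generates_ideal_def)
  have "\<exists>C\<ge>0. eventually (\<lambda>z. norm (g z) \<le> C * gen_abs F z) (nhds 0)" if "g \<in> G" for g
  proof -
    have "abs_germ g \<in> germ.span (abs_germ ` F)"
      using F(3) G(3) that germ.span_base[of "abs_germ g" "abs_germ ` G"] by auto
    from span_abs_germ_bound[OF F(1,2) this] show ?thesis using G(2) that by blast
  qed
  then obtain C where C: "\<And>g. g \<in> G \<Longrightarrow> C g \<ge> 0"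
    "\<And>g. g \<in> G \<Longrightarrow> eventually (\<lambda>z. norm (g z) \<le> C g * gen_abs F z) (nhds 0)"
    by metis
  have "eventually (\<lambda>z. \<forall>g\<in>G. norm (g z) \<le> C g * gen_abs F z) (nhds 0)"
    using C(2) G(1) by (simp add: eventually_ball_finite)
  then have "eventually (\<lambda>z. gen_abs G z \<le> (sum C G + 1) * gen_abs F z) (nhds 0)"
  proof eventually_elim
    case (elim z)
    have "gen_abs G z \<le> (\<Sum>g\<in>G. C g * gen_abs F z)"
      unfolding gen_abs_def[of G] using elim by (intro sum_mono) auto
    also have "\<dots> \<le> (sum C G + 1) * gen_abs F z"
      using gen_abs_nonneg[of F z] by (simp add: sum_distrib_right distrib_right)
    finally show ?case .
  qed
  moreover have "sum C G + 1 > 0" using C(1) by (simp add: sum_nonneg add_nonneg_pos)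
  ultimately show ?thesis by blast
qed

end

theory Submission
  imports Defs "HOL-Complex_Analysis.Cauchy_Integral_Formula"
begin

text \<open>The estimate is Hoelder's inequality in disguise. Suppose that \<open>|J|\<^sup>2 e\<^sup>-\<^sup>2\<^sup>c\<^sup>u\<close> and \<open>|J|\<^sup>-\<^sup>2\<^sup>b\<close> are
  integrable near the origin, with \<open>b > 0\<close>, and put \<open>a = cb/(1+b)\<close>. Then \<open>e\<^sup>-\<^sup>2\<^sup>a\<^sup>u\<close> is a weighted geometric
  mean of these two functions, the powers of \<open>|J|\<close> cancelling, so it is at most their sum
  (\<open>exp_weight_le_sum\<close>) and is integrable as well (\<open>integrable_exp_weight\<close>). Hence
  \<open>c\<^sub>o(u) \<ge> cb/(1+b)\<close>, or \<open>c \<le> c\<^sub>o(u)/b + c\<^sub>o(u)\<close>, and it remains to let \<open>c\<close> and \<open>b\<close> approach the jumping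
  numbers.

  This needs at least one admissible \<open>b > 0\<close>, so the analytic content is that
  \<open>c\<^sub>o(log |J|) > 0\<close> for \<open>J \<noteq> {0}\<close> (\<open>log_ideal_abs_exponent_pos\<close>): a small negative power of \<open>|f|\<close> is
  integrable near the origin if \<open>f\<close> is holomorphic with a nonzero germ
  (\<open>holomorphic_negative_power_integrable\<close>). The proof avoids Weierstrass preparation. On some complex
  line through the origin \<open>f\<close> vanishes to a finite order \<open>m\<close>, so on all nearby parallel real segments
  the real part of a rotation of \<open>f\<close> has an \<open>m\<close>-th derivative bounded away from zero
  (\<open>holomorphic_nonflat_direction\<close>). A real function of this kind has small sublevel sets
  (\<open>emeasure_sublevel_le\<close>): many well separated points with small values would, by repeated use of the
  mean value theorem, produce a point with a small \<open>m\<close>-th derivative. Averaging over translates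
  (\<open>emeasure_lborel_translation_average\<close>) bounds the volume of the sublevel sets of \<open>|f|\<close>, and summing
  over dyadic levels (\<open>nn_integral_negative_power_finite\<close>) bounds the integral.\<close>

section \<open>Sublevel sets of real functions with a large derivative\<close>

text \<open>Separation survives differentiation: the mean value theorem on every second gap of
  \<open>2\<^sup>m\<close> points yields \<open>2\<^sup>m\<^sup>-\<^sup>1\<close> points, still \<open>\<delta>\<close> apart because a full unused gap lies between two
  neighbours, at which the derivative is small. Halving the number of points is the price for not
  having to keep track of the gaps.\<close>

lemma iterated_MVT_separated:
  fixes \<phi> :: "nat \<Rightarrow> real \<Rightarrow> real"
  assumes "\<And>k x. x \<in> {a..b} \<Longrightarrow> (\<phi> k has_real_derivative \<phi> (Suc k) x) (at x)"
    and "\<delta> > 0"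
    and "\<And>i. i < 2 ^ m \<Longrightarrow> x i \<in> {a..b}"
    and "\<And>i. Suc i < 2 ^ m \<Longrightarrow> x i + \<delta> \<le> x (Suc i)"
    and "\<And>i. i < 2 ^ m \<Longrightarrow> \<bar>\<phi> 0 (x i)\<bar> < t"
  shows "\<exists>y\<in>{a..b}. \<bar>\<phi> m y\<bar> < (2 / \<delta>) ^ m * t"
  using assms
proof (induction m arbitrary: \<phi> x t)
  case 0
  then show ?case by (intro bexI[of _ "x 0"]) auto
next
  case (Suc m)
  have "\<exists>y. x (2*i) < y \<and> y < x (Suc (2*i)) \<and> \<bar>\<phi> 1 y\<bar> < 2 / \<delta> * t" if i: "i < 2 ^ m" for i
  proof -
    have le: "Suc (2*i) < 2 ^ Suc m" "2*i < 2 ^ Suc m" using i by auto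
    note gap = Suc.prems(4)[OF le(1)]
    have "x (2*i) < x (Suc (2*i))" using gap \<open>\<delta> > 0\<close> by simp
    then obtain y where y: "x (2*i) < y" "y < x (Suc (2*i))"
      and eq: "\<phi> 0 (x (Suc (2*i))) - \<phi> 0 (x (2*i)) = (x (Suc (2*i)) - x (2*i)) * \<phi> 1 y"
      using MVT2[of "x (2*i)" "x (Suc (2*i))" "\<phi> 0" "\<phi> 1"] Suc.prems(1)[of _ 0]
        Suc.prems(3)[OF le(1)] Suc.prems(3)[OF le(2)] by auto
    have "\<delta> * \<bar>\<phi> 1 y\<bar> \<le> (x (Suc (2*i)) - x (2*i)) * \<bar>\<phi> 1 y\<bar>"
      using gap by (intro mult_right_mono) auto
    also have "\<dots> = \<bar>\<phi> 0 (x (Suc (2*i))) - \<phi> 0 (x (2*i))\<bar>"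
      unfolding eq using gap \<open>\<delta> > 0\<close> by (simp add: abs_mult)
    also have "\<dots> < 2 * t"
      using Suc.prems(5)[OF le(1)] Suc.prems(5)[OF le(2)] by linarith
    finally show ?thesis using y \<open>\<delta> > 0\<close> by (intro exI[of _ y]) (auto simp: field_simps)
  qed
  then obtain y where y: "\<And>i. i < 2 ^ m \<Longrightarrow> x (2*i) < y i \<and> y i < x (Suc (2*i)) \<and> \<bar>\<phi> 1 (y i)\<bar> < 2 / \<delta> * t"
    by metis
  have "\<exists>z\<in>{a..b}. \<bar>\<phi> (Suc m) z\<bar> < (2 / \<delta>) ^ m * (2 / \<delta> * t)"
  proof (rule Suc.IH[of "\<lambda>k. \<phi> (Suc k)" y])
    show "(\<phi> (Suc k) has_real_derivative \<phi> (Suc (Suc k)) z) (at z)" if "z \<in> {a..b}" for k z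
      by (rule Suc.prems(1)[OF that])
    show "y i \<in> {a..b}" if "i < 2 ^ m" for i
      using y[OF that] Suc.prems(3)[of "2*i"] Suc.prems(3)[of "Suc (2*i)"] that by auto
    show "y i + \<delta> \<le> y (Suc i)" if "Suc i < 2 ^ m" for i
      using y[OF that] y[of i] Suc.prems(4)[of "Suc (2*i)"] that by auto
    show "\<bar>\<phi> (Suc 0) (y i)\<bar> < 2 / \<delta> * t" if "i < 2 ^ m" for i
      using y[OF that] by simp
  qed (fact \<open>\<delta> > 0\<close>)
  then show ?case by (simp add: ac_simps)
qed

text \<open>Greedy choice from the left: take a point within \<open>\<delta>\<close> of the infimum, discard everything less
  than \<open>\<delta>\<close> to its right, and repeat. What each step discards fits into one interval of
  length \<open>2\<delta>\<close>.\<close>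

lemma separated_sequence_or_cover:
  fixes E :: "real set"
  assumes "bdd_below E" and "\<delta> > 0"
  shows "(\<exists>x. (\<forall>i<N. x i \<in> E) \<and> (\<forall>i. Suc i < N \<longrightarrow> x i + \<delta> \<le> x (Suc i))) \<or>
    (\<exists>S. finite S \<and> card S \<le> N \<and> E \<subseteq> (\<Union>s\<in>S. {s..s + 2 * \<delta>}))"
  using assms(1)
proof (induction N arbitrary: E)
  case 0
  then show ?case by auto
next
  case (Suc N)
  show ?case
  proof (cases "E = {}")
    case True
    then show ?thesis by (intro disjI2 exI[of _ "{}"]) auto
  next
    case False
    have "Inf E < Inf E + \<delta>" using \<open>\<delta> > 0\<close> by simp
    then obtain p where p: "p \<in> E" "p < Inf E + \<delta>"
      using cInf_less_iff[OF False Suc.prems] by blast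
    let ?E = "E \<inter> {p + \<delta>..}"
    have bdd: "bdd_below ?E" by auto
    show ?thesis using Suc.IH[OF bdd]
    proof (elim disjE exE conjE)
      fix x assume x: "\<forall>i<N. x i \<in> ?E" "\<forall>i. Suc i < N \<longrightarrow> x i + \<delta> \<le> x (Suc i)"
      show ?thesis
      proof (intro disjI1 exI[of _ "case_nat p x"] conjI allI impI)
        fix i
        show "case_nat p x i \<in> E" if "i < Suc N"
          using that x p by (cases i) auto
        show "case_nat p x i + \<delta> \<le> case_nat p x (Suc i)" if "Suc i < Suc N"
          using that x by (cases i) auto
      qed
    next
      fix S assume S: "finite S" "card S \<le> N" "?E \<subseteq> (\<Union>s\<in>S. {s..s + 2 * \<delta>})"
      have "E - ?E \<subseteq> {Inf E..Inf E + 2 * \<delta>}"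
        using p cInf_lower[OF _ Suc.prems] by fastforce
      then have "E \<subseteq> (\<Union>s\<in>insert (Inf E) S. {s..s + 2 * \<delta>})" using S(3) by blast
      moreover have "card (insert (Inf E) S) \<le> Suc N"
        using S by (simp add: card_insert_if)
      ultimately show ?thesis using S(1) by (intro disjI2 exI[of _ "insert (Inf E) S"]) auto
    qed
  qed
qed

text \<open>A sublevel set cannot contain \<open>2\<^sup>m\<close> separated points, since these would produce a point
  where the \<open>m\<close>-th derivative is too small; hence it is covered by few short intervals. The constant
  depends on \<open>\<phi>\<close> only through \<open>c\<close> and \<open>m\<close>, so the bound is uniform over families of functions.\<close>

lemma emeasure_sublevel_le:
  fixes \<phi> :: "nat \<Rightarrow> real \<Rightarrow> real"
  assumes "\<And>k x. x \<in> {a..b} \<Longrightarrow> (\<phi> k has_real_derivative \<phi> (Suc k) x) (at x)"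
    and "\<And>x. x \<in> {a..b} \<Longrightarrow> c \<le> \<bar>\<phi> m x\<bar>"
    and "\<delta> > 0"
    and "E \<subseteq> {a..b}"
    and "\<And>x. x \<in> E \<Longrightarrow> \<bar>\<phi> 0 x\<bar> < c * (\<delta> / 2) ^ m"
  shows "emeasure lborel E \<le> ennreal (2 ^ m * (2 * \<delta>))"
proof -
  have False if x: "\<forall>i<2 ^ m. x i \<in> E" "\<forall>i. Suc i < 2 ^ m \<longrightarrow> x i + \<delta> \<le> x (Suc i)" for x
  proof -
    have "\<exists>y\<in>{a..b}. \<bar>\<phi> m y\<bar> < (2 / \<delta>) ^ m * (c * (\<delta> / 2) ^ m)"
      by (rule iterated_MVT_separated[where x = x]) (use assms x in auto)
    moreover have "(2 / \<delta>) ^ m * (c * (\<delta> / 2) ^ m) = c"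
      using \<open>\<delta> > 0\<close> by (simp add: power_divide)
    ultimately show False using assms(2) by (metis not_le)
  qed
  moreover have "bdd_below E" using assms(4) by (rule bdd_below_mono[OF bdd_below_Icc])
  ultimately obtain S where S: "finite S" "card S \<le> 2 ^ m" "E \<subseteq> (\<Union>s\<in>S. {s..s + 2 * \<delta>})"
    using separated_sequence_or_cover[of E \<delta> "2 ^ m"] \<open>\<delta> > 0\<close> by blast
  have "emeasure lborel E \<le> emeasure lborel (\<Union>s\<in>S. {s..s + 2 * \<delta>})"
    using S by (intro emeasure_mono) (auto intro!: borel_closed)
  also have "\<dots> \<le> (\<Sum>s\<in>S. emeasure lborel {s..s + 2 * \<delta>})"
    using S by (intro emeasure_subadditive_finite) auto
  also have "\<dots> = ennreal (real (card S) * (2 * \<delta>))"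
    using \<open>\<delta> > 0\<close> by (simp add: ennreal_mult ennreal_of_nat_eq_real_of_nat)
  also have "\<dots> \<le> ennreal (2 ^ m * (2 * \<delta>))"
    using S(2) \<open>\<delta> > 0\<close> by (intro ennreal_leI mult_right_mono) (auto simp flip: of_nat_power_le_of_nat_cancel_iff of_nat_le_iff)
  finally show ?thesis .
qed

section \<open>Holomorphic functions along complex lines\<close>

lemma holomorphic_several_continuous_on:
  assumes "holomorphic_several f U"
  shows "continuous_on U f"
  using assms unfolding holomorphic_several_def continuous_on_eq_continuous_within
  by (blast intro: has_derivative_continuous continuous_at_imp_continuous_at_within)

lemma norm_cvec_scale: "norm (c *s v) = norm c * norm (v :: complex ^ 'n::finite)"
  by (simp add: norm_vec_def norm_mult L2_set_right_distrib)

lemma holomorphic_on_complex_line: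
  fixes f :: "complex ^ ('n::finite) \<Rightarrow> complex"
  assumes "holomorphic_several f U" and "\<And>\<zeta>. \<zeta> \<in> S \<Longrightarrow> w + \<zeta> *s v \<in> U"
  shows "(\<lambda>\<zeta>. f (w + \<zeta> *s v)) holomorphic_on S"
  unfolding holomorphic_on_def
proof
  fix \<zeta> assume "\<zeta> \<in> S"
  then obtain D where D: "(f has_derivative D) (at (w + \<zeta> *s v))" "\<And>c v. D (c *s v) = c * D v"
    using assms unfolding holomorphic_several_def by meson
  have "bounded_linear (\<lambda>c. c *s v)"
  proof (rule bounded_linear_intro)
    show "norm (c *s v) \<le> norm c * norm v" for c by (simp add: norm_cvec_scale)
  qed (auto simp: vec_eq_iff algebra_simps)
  then have "((\<lambda>\<zeta>. w + \<zeta> *s v) has_derivative (\<lambda>c. c *s v)) (at \<zeta> within S)"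
    by (auto intro!: derivative_eq_intros bounded_linear.has_derivative[of "\<lambda>c. c *s v"])
  from has_derivative_compose[OF this D(1)]
  have "((\<lambda>\<zeta>. f (w + \<zeta> *s v)) has_derivative (\<lambda>c. D v * c)) (at \<zeta> within S)"
    by (simp add: D(2) mult.commute)
  then show "(\<lambda>\<zeta>. f (w + \<zeta> *s v)) field_differentiable at \<zeta> within S"
    unfolding field_differentiable_def has_field_derivative_def by blast
qed

text \<open>In some direction \<open>v\<close> the restriction of \<open>f\<close> to the complex line through \<open>0\<close> is not identically
  zero, so one of its derivatives at \<open>0\<close>, say of order \<open>m\<close>, has a value \<open>D \<noteq> 0\<close>. By Cauchy's
  inequality this derivative moves little when the line is translated by a small \<open>w\<close>. Rotating by the
  argument of \<open>D\<close> and taking real parts gives real functions \<open>\<phi> w\<close> of a real parameter, whose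
  \<open>m\<close>-th derivatives are bounded below uniformly in \<open>w\<close>. Here \<open>\<phi> w k\<close> is the \<open>k\<close>-th derivative.\<close>

lemma holomorphic_nonflat_direction:
  fixes f :: "complex ^ ('n::finite) \<Rightarrow> complex"
  assumes hol: "holomorphic_several f (ball 0 r)" and "r > 0"
    and nz: "\<not> eventually (\<lambda>z. f z = 0) (nhds 0)"
  obtains \<rho> c :: real and \<phi> :: "complex ^ 'n \<Rightarrow> nat \<Rightarrow> real \<Rightarrow> real"
    and m :: nat and v :: "complex ^ 'n"
  where "\<rho> > 0" "c > 0"
    "\<And>w k x. norm w < \<rho> \<Longrightarrow> x \<in> {-\<rho>..\<rho>} \<Longrightarrow> (\<phi> w k has_real_derivative \<phi> w (Suc k) x) (at x)"
    "\<And>w x. norm w < \<rho> \<Longrightarrow> x \<in> {-\<rho>..\<rho>} \<Longrightarrow> c \<le> \<bar>\<phi> w m x\<bar>"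
    "\<And>w x. norm w < \<rho> \<Longrightarrow> x \<in> {-\<rho>..\<rho>} \<Longrightarrow> \<bar>\<phi> w 0 x\<bar> \<le> norm (f (w + x *\<^sub>R v))"
proof -
  \<comment> \<open>Halving the radius puts the parameter \<open>1\<close>, where the restriction to the line is nonzero,
    inside the disc of radius \<open>3/2\<close> on which all translated restrictions are holomorphic.\<close>
  have "\<exists>v\<in>ball 0 (r/2). f v \<noteq> 0"
  proof (rule ccontr)
    assume "\<not> ?thesis"
    moreover have "eventually (\<lambda>z. z \<in> ball (0::complex^'n) (r/2)) (nhds 0)"
      using \<open>r > 0\<close> by (intro eventually_nhds_in_open) auto
    ultimately have "eventually (\<lambda>z. f z = 0) (nhds 0)" by (auto elim: eventually_mono)
    with nz show False by simp
  qed
  then obtain v where v: "norm v < r/2" "f v \<noteq> 0" by auto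
  define h where "h w \<zeta> = f (w + \<zeta> *s v)" for w \<zeta>
  have arg: "norm (w + \<zeta> *s v) \<le> norm w + norm \<zeta> * (r/2)" for w \<zeta>
    using norm_triangle_ineq[of w "\<zeta> *s v"] mult_left_mono[of "norm v" "r/2" "norm \<zeta>"] v(1)
    by (simp add: norm_cvec_scale)
  have hh: "h w holomorphic_on ball 0 (3/2)" if "norm w < r/4" for w
    unfolding h_def
  proof (rule holomorphic_on_complex_line[OF hol])
    fix \<zeta> :: complex assume "\<zeta> \<in> ball 0 (3/2)"
    then have "norm \<zeta> * (r/2) \<le> 3/2 * (r/2)" using \<open>r > 0\<close> by (intro mult_right_mono) auto
    with arg[of w \<zeta>] that have "norm (w + \<zeta> *s v) < r" by linarith
    then show "w + \<zeta> *s v \<in> ball 0 r" by simp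
  qed
  have h0: "h 0 holomorphic_on ball 0 (3/2)" using \<open>r > 0\<close> by (intro hh) auto
  have "h 0 1 \<noteq> 0" using v(2) by (simp add: h_def)
  then obtain m where m: "(deriv ^^ m) (h 0) 0 \<noteq> 0"
    using holomorphic_fun_eq_0_on_ball[OF h0, of 1] by auto
  define D where "D = (deriv ^^ m) (h 0) 0"
  have D: "D \<noteq> 0" using m by (simp add: D_def)
  have hd: "(deriv ^^ k) (h w) holomorphic_on ball 0 (3/2)" if "norm w < r/4" for w k
    using hh[OF that] by (intro holomorphic_higher_deriv) auto
  have "continuous_on (ball 0 (3/2)) ((deriv ^^ m) (h 0))"
    using hd[of 0 m] \<open>r > 0\<close> by (intro holomorphic_on_imp_continuous_on) auto
  then have "isCont ((deriv ^^ m) (h 0)) 0" by (simp add: continuous_on_eq_continuous_at)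
  then obtain d where d: "d > 0" "\<And>x. dist x 0 < d \<Longrightarrow> dist ((deriv ^^ m) (h 0) x) D < norm D / 4"
    unfolding continuous_at_eps_delta D_def using D[unfolded D_def]
    by (metis zero_less_divide_iff zero_less_norm_iff zero_less_numeral)
  \<comment> \<open>With this bound on \<open>h w - h 0\<close>, Cauchy's inequality on discs of radius \<open>1/2\<close> makes the
    \<open>m\<close>-th derivatives differ by at most \<open>norm D / 4\<close>.\<close>
  define \<epsilon> where "\<epsilon> = norm D * (1/2) ^ m / (4 * fact m)"
  have "\<epsilon> > 0" using D by (simp add: \<epsilon>_def)
  have "uniformly_continuous_on (cball 0 (3/4*r)) f"
  proof (rule compact_uniformly_continuous)
    show "continuous_on (cball 0 (3/4*r)) f"
      using \<open>r > 0\<close> by (intro continuous_on_subset[OF holomorphic_several_continuous_on[OF hol]]) auto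
  qed simp
  then obtain \<eta> where \<eta>: "\<eta> > 0" "\<And>z z'. z \<in> cball 0 (3/4*r) \<Longrightarrow> z' \<in> cball 0 (3/4*r) \<Longrightarrow> dist z' z < \<eta>
      \<Longrightarrow> dist (f z') (f z) < \<epsilon>"
    unfolding uniformly_continuous_on_def using \<open>\<epsilon> > 0\<close> by metis
  define \<rho> where "\<rho> = min (d/2) (min \<eta> (min (r/4) (1/2)))"
  have \<rho>: "\<rho> > 0" "\<rho> < d" "\<rho> \<le> \<eta>" "\<rho> \<le> r/4" "\<rho> \<le> 1/2"
    using d(1) \<eta>(1) \<open>r > 0\<close> by (auto simp: \<rho>_def)
  have close: "norm ((deriv ^^ m) (h w) (of_real x) - D) \<le> norm D / 2"
    if w: "norm w < \<rho>" and x: "x \<in> {-\<rho>..\<rho>}" for w x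
  proof -
    let ?x = "of_real x :: complex"
    have nx: "norm ?x \<le> 1/2" "norm ?x < d" using x \<rho> by auto
    have sub: "cball ?x (1/2) \<subseteq> ball 0 (3/2)"
    proof
      fix \<zeta> assume "\<zeta> \<in> cball ?x (1/2)"
      then show "\<zeta> \<in> ball 0 (3/2)"
        using nx(1) norm_triangle_sub[of \<zeta> ?x] by (auto simp: dist_norm norm_minus_commute)
    qed
    have hw: "h w holomorphic_on ball 0 (3/2)" using w \<rho> by (intro hh) auto
    have holdiff: "(\<lambda>\<zeta>. h w \<zeta> - h 0 \<zeta>) holomorphic_on ball 0 (3/2)"
      using hw h0 by (intro holomorphic_intros)
    have "norm ((deriv ^^ m) (\<lambda>\<zeta>. h w \<zeta> - h 0 \<zeta>) ?x) \<le> fact m * \<epsilon> / (1/2) ^ m"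
    proof (rule Cauchy_inequality)
      show "(\<lambda>\<zeta>. h w \<zeta> - h 0 \<zeta>) holomorphic_on ball ?x (1/2)"
        using holdiff sub ball_subset_cball[of ?x "1/2"] by (meson holomorphic_on_subset order_trans)
      show "continuous_on (cball ?x (1/2)) (\<lambda>\<zeta>. h w \<zeta> - h 0 \<zeta>)"
        using holomorphic_on_imp_continuous_on[OF holdiff] sub by (rule continuous_on_subset)
      fix \<zeta> assume "norm (?x - \<zeta>) = 1/2"
      then have n: "norm \<zeta> \<le> 1"
        using nx(1) norm_triangle_sub[of \<zeta> ?x] by (simp add: norm_minus_commute)
      then have n': "norm \<zeta> * (r/2) \<le> r/2" using \<open>r > 0\<close> by (simp add: mult_left_le_one_le)
      have "dist (f (w + \<zeta> *s v)) (f (0 + \<zeta> *s v)) < \<epsilon>"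
      proof (rule \<eta>(2))
        have "norm (w + \<zeta> *s v) \<le> 3/4*r" "norm (0 + \<zeta> *s v) \<le> 3/4*r"
          using arg[of w \<zeta>] arg[of 0 \<zeta>] n' w \<rho>(4) \<open>r > 0\<close> unfolding norm_zero by linarith+
        then show "0 + \<zeta> *s v \<in> cball 0 (3/4*r)" "w + \<zeta> *s v \<in> cball 0 (3/4*r)" by auto
        show "dist (w + \<zeta> *s v) (0 + \<zeta> *s v) < \<eta>" using w \<rho>(3) by (simp add: dist_norm)
      qed
      then show "norm (h w \<zeta> - h 0 \<zeta>) \<le> \<epsilon>" by (simp add: h_def dist_norm)
    qed simp
    also have "fact m * \<epsilon> / (1/2) ^ m = norm D / 4" by (simp add: \<epsilon>_def)
    also have "(deriv ^^ m) (\<lambda>\<zeta>. h w \<zeta> - h 0 \<zeta>) ?x = (deriv ^^ m) (h w) ?x - (deriv ^^ m) (h 0) ?x"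
      using nx(1) by (intro higher_deriv_diff[OF hw h0]) auto
    finally have "norm ((deriv ^^ m) (h w) ?x - (deriv ^^ m) (h 0) ?x) \<le> norm D / 4" .
    moreover have "norm ((deriv ^^ m) (h 0) ?x - D) < norm D / 4"
      using d(2)[of ?x] nx(2) by (simp add: dist_norm)
    ultimately show ?thesis
      using norm_triangle_ineq[of "(deriv ^^ m) (h w) ?x - (deriv ^^ m) (h 0) ?x" "(deriv ^^ m) (h 0) ?x - D"]
      by simp
  qed
  define e where "e = cnj D / of_real (norm D)"
  have e: "norm e = 1" using D by (simp add: e_def norm_divide)
  have eD: "e * D = of_real (norm D)"
  proof -
    have "cnj D * D = of_real (norm D) * of_real (norm D)"
      by (metis complex_norm_square mult.commute of_real_mult power2_eq_square)
    then show ?thesis using D by (simp add: e_def)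
  qed
  define \<phi> where "\<phi> w k x = Re (e * (deriv ^^ k) (h w) (of_real x))" for w k x
  show ?thesis
  proof (rule that[of \<rho> "norm D / 2" \<phi> m v])
    show "\<rho> > 0" "norm D / 2 > 0" using \<rho> D by auto
    fix w :: "complex ^ 'n" and x :: real assume w: "norm w < \<rho>" and x: "x \<in> {-\<rho>..\<rho>}"
    show "norm D / 2 \<le> \<bar>\<phi> w m x\<bar>"
    proof -
      let ?y = "(deriv ^^ m) (h w) (of_real x)"
      have "\<bar>Re (e * (?y - D))\<bar> \<le> norm (e * (?y - D))" by (rule abs_Re_le_cmod)
      also have "\<dots> \<le> norm D / 2" using close[OF w x] e by (simp add: norm_mult)
      also have "Re (e * (?y - D)) = \<phi> w m x - norm D"
        unfolding right_diff_distrib eD by (simp add: \<phi>_def)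
      finally show ?thesis by linarith
    qed
    show "\<bar>\<phi> w 0 x\<bar> \<le> norm (f (w + x *\<^sub>R v))"
    proof -
      have "\<bar>\<phi> w 0 x\<bar> \<le> norm (e * h w (of_real x))" 
        using abs_Re_le_cmod[of "e * h w (of_real x)"] by (simp add: \<phi>_def)
      also have "\<dots> = norm (h w (of_real x))" using e by (simp add: norm_mult)
      also have "h w (of_real x) = f (w + x *\<^sub>R v)"
      proof -
        have "complex_of_real x *s v = x *\<^sub>R v" by (simp add: vec_eq_iff) (simp add: scaleR_conv_of_real)
        then show ?thesis by (simp add: h_def)
      qed
      finally show ?thesis .
    qed
    fix k
    have "of_real x \<in> ball (0::complex) (3/2)" using x \<rho> by auto
    moreover have "(deriv ^^ k) (h w) holomorphic_on ball 0 (3/2)" using w \<rho> by (intro hd) auto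
    ultimately have "((deriv ^^ k) (h w) has_field_derivative (deriv ^^ Suc k) (h w) (of_real x)) (at (of_real x))"
      by (auto intro: holomorphic_derivI)
    then have "((\<lambda>\<zeta>. e * (deriv ^^ k) (h w) \<zeta>) has_field_derivative e * (deriv ^^ Suc k) (h w) (of_real x)) (at (of_real x))"
      by (rule DERIV_cmult)
    then have "((\<lambda>y. e * (deriv ^^ k) (h w) (of_real y)) has_vector_derivative e * (deriv ^^ Suc k) (h w) (of_real x)) (at x)"
      by (rule has_vector_derivative_real_field)
    then have "((\<lambda>y. Re (e * (deriv ^^ k) (h w) (of_real y))) has_vector_derivative Re (e * (deriv ^^ Suc k) (h w) (of_real x))) (at x)"
      by (rule bounded_linear.has_vector_derivative[OF bounded_linear_Re])
    then show "(\<phi> w k has_real_derivative \<phi> w (Suc k) x) (at x)"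
      unfolding \<phi>_def[abs_def] has_real_derivative_iff_has_vector_derivative .
  qed
qed

section \<open>Integrability of negative powers of holomorphic functions\<close>

text \<open>Averaging the translation invariance of Lebesgue measure over the shifts by \<open>x v\<close> bounds the
  volume of \<open>A\<close> by the length of its slices in the direction \<open>v\<close>, without choosing coordinates
  adapted to \<open>v\<close>.\<close>

lemma emeasure_lborel_translation_average:
  fixes A :: "'a::euclidean_space set" and v :: 'a and K :: ennreal
  assumes A[measurable]: "A \<in> sets borel" and "\<rho> \<ge> 0"
    and W[measurable]: "W \<in> sets borel" and AW: "\<And>z x. z \<in> A \<Longrightarrow> x \<in> {-\<rho>..\<rho>} \<Longrightarrow> z - x *\<^sub>R v \<in> W"
    and slice: "\<And>w. w \<in> W \<Longrightarrow> emeasure lborel {x\<in>{-\<rho>..\<rho>}. w + x *\<^sub>R v \<in> A} \<le> K"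
  shows "ennreal (2 * \<rho>) * emeasure lborel A \<le> K * emeasure lborel W"
proof -
  have trans: "(\<integral>\<^sup>+w. indicator A (w + t) \<partial>lborel) = emeasure lborel A" for t :: 'a
  proof -
    have "emeasure lborel A = (\<integral>\<^sup>+w. indicator A w \<partial>distr lborel borel ((+) t))"
      unfolding lborel_distr_plus by simp
    also have "\<dots> = (\<integral>\<^sup>+w. indicator A (t + w) \<partial>lborel)"
      by (subst nn_integral_distr) auto
    finally show ?thesis by (simp add: add.commute)
  qed
  have "ennreal (2 * \<rho>) * emeasure lborel A = (\<integral>\<^sup>+x. indicator {-\<rho>..\<rho>} x * emeasure lborel A \<partial>lborel)"
    using \<open>\<rho> \<ge> 0\<close> by (simp add: nn_integral_multc)
  also have "\<dots> = (\<integral>\<^sup>+x. (\<integral>\<^sup>+w. indicator {-\<rho>..\<rho>} x * indicator A (w + x *\<^sub>R v) \<partial>lborel) \<partial>lborel)"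
    by (intro nn_integral_cong) (simp add: nn_integral_cmult trans)
  also have "\<dots> = (\<integral>\<^sup>+w. (\<integral>\<^sup>+x. indicator {-\<rho>..\<rho>} x * indicator A (w + x *\<^sub>R v) \<partial>lborel) \<partial>lborel)"
    by (rule lborel_pair.Fubini') measurable
  also have "\<dots> \<le> (\<integral>\<^sup>+w. K * indicator W w \<partial>lborel)"
  proof (intro nn_integral_mono)
    fix w :: 'a
    have meas: "{x \<in> {-\<rho>..\<rho>}. w + x *\<^sub>R v \<in> A} \<in> sets borel" by measurable
    have "(\<integral>\<^sup>+x. indicator {-\<rho>..\<rho>} x * indicator A (w + x *\<^sub>R v) \<partial>lborel)
        = (\<integral>\<^sup>+x. indicator {x \<in> {-\<rho>..\<rho>}. w + x *\<^sub>R v \<in> A} x \<partial>lborel)"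
      by (intro nn_integral_cong) (auto simp: indicator_def)
    also have "\<dots> = emeasure lborel {x \<in> {-\<rho>..\<rho>}. w + x *\<^sub>R v \<in> A}" using meas by simp
    finally have eq: "(\<integral>\<^sup>+x. indicator {-\<rho>..\<rho>} x * indicator A (w + x *\<^sub>R v) \<partial>lborel)
      = emeasure lborel {x \<in> {-\<rho>..\<rho>}. w + x *\<^sub>R v \<in> A}" .
    show "(\<integral>\<^sup>+x. indicator {-\<rho>..\<rho>} x * indicator A (w + x *\<^sub>R v) \<partial>lborel) \<le> K * indicator W w"
    proof (cases "w \<in> W")
      case True
      then show ?thesis unfolding eq using slice by simp
    next
      case False
      then have "{x \<in> {-\<rho>..\<rho>}. w + x *\<^sub>R v \<in> A} = {}" using AW by fastforce
      then show ?thesis unfolding eq by (simp only: emeasure_empty zero_le)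
    qed
  qed
  also have "\<dots> = K * emeasure lborel W" by (simp add: nn_integral_cmult)
  finally show ?thesis .
qed

text \<open>Dyadic layers: at \<open>\<delta> = 4\<^sup>-\<^sup>k\<close> the sublevel sets have measure of order \<open>4\<^sup>-\<^sup>k\<close>, while the
  exponent is chosen so that the integrand between two consecutive levels is at most of order \<open>2\<^sup>k\<close>.
  The factor \<open>Suc m\<close> in place of \<open>m\<close> lets the same exponent serve for \<open>m = 0\<close>.\<close>

lemma nn_integral_negative_power_finite:
  fixes G :: "'a \<Rightarrow> real"
  assumes A[measurable]: "A \<in> sets M" and fin: "emeasure M A < \<infinity>"
    and G[measurable]: "(\<lambda>z. G z) \<in> borel_measurable (restrict_space M A)"
    and "c > 0" and "K \<ge> 0"
    and small: "\<And>\<delta>. \<delta> > 0 \<Longrightarrow> emeasure M {z\<in>A. G z < c * (\<delta>/2) ^ m} \<le> ennreal (K * \<delta>)"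
  shows "(\<integral>\<^sup>+z\<in>A. (if G z = 0 then \<infinity> else ennreal (G z powr (- (1 / (2 * real (Suc m)))))) \<partial>M) < \<infinity>"
proof -
  define \<epsilon> where "\<epsilon> = 1 / (2 * real (Suc m))"
  define \<tau> where "\<tau> k = c * ((1/4) ^ k / 2) ^ m" for k :: nat
  define L where "L k = {z\<in>A. G z < \<tau> k}" for k
  define C where "C = 4 * c powr (- \<epsilon>)"
  have "\<epsilon> > 0" "m * \<epsilon> \<le> 1/2" by (auto simp: \<epsilon>_def field_simps)
  have \<tau>: "\<tau> k > 0" for k using \<open>c > 0\<close> by (simp add: \<tau>_def)
  have "C > 0" using \<open>c > 0\<close> by (simp add: C_def)
  have \<tau>_powr: "\<tau> k powr (- \<epsilon>) \<le> c powr (- \<epsilon>) * (2 * 2 ^ k)" for k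
  proof -
    let ?q = "2 * 4 ^ k :: real"
    have "\<tau> k = c * inverse (?q ^ m)"
      by (simp add: \<tau>_def power_divide divide_simps power_mult_distrib)
    then have "\<tau> k powr (- \<epsilon>) = c powr (- \<epsilon>) * (inverse (?q ^ m)) powr (- \<epsilon>)"
      using \<open>c > 0\<close> by (simp add: powr_mult)
    also have "inverse (?q ^ m) = ?q powr (- real m)"
      by (simp add: powr_minus powr_realpow)
    also have "(?q powr (- real m)) powr (- \<epsilon>) = ?q powr (m * \<epsilon>)" by (simp add: powr_powr)
    also have "\<dots> \<le> ?q powr (1/2)"
    proof (rule powr_mono)
      have "(1::real) \<le> 4 ^ k" by simp
      then show "1 \<le> ?q" by linarith
    qed fact
    also have "\<dots> = sqrt ?q" by (simp add: powr_half_sqrt)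
    also have "\<dots> \<le> sqrt ((2 * 2 ^ k)\<^sup>2)"
      by (intro real_sqrt_le_mono) (simp add: power_mult_distrib power2_eq_square flip: power_mult_distrib)
    also have "\<dots> = 2 * 2 ^ k" by (subst real_sqrt_abs) simp
    finally show ?thesis using \<open>c > 0\<close> by simp
  qed
  have L[measurable]: "L k \<in> sets M" for k
  proof -
    have "{z \<in> space (restrict_space M A). G z < \<tau> k} \<in> sets (restrict_space M A)" by measurable
    moreover have "{z \<in> space (restrict_space M A). G z < \<tau> k} = L k"
      using sets.sets_into_space[OF A] by (auto simp: space_restrict_space L_def)
    ultimately show ?thesis using A by (simp add: sets_restrict_space_iff)
  qed
  have Lm: "emeasure M (L k) \<le> ennreal (K * (1/4) ^ k)" for k
    using small[of "(1/4) ^ k"] by (simp add: L_def \<tau>_def)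
  have bound: "(if G z = 0 then \<infinity> else ennreal (G z powr (- \<epsilon>))) * indicator A z
      \<le> ennreal C * (indicator A z + (\<Sum>k. ennreal (2 ^ k) * indicator (L k) z))" for z
  proof (cases "z \<in> A")
    case z: True
    let ?S = "\<Sum>k. ennreal (2 ^ k) * indicator (L k) z :: ennreal"
    show ?thesis
    \<comment> \<open>A point in all layers makes the sum infinite; this includes the zeros of \<open>G\<close>.\<close>
    proof (cases "\<forall>k. z \<in> L k")
      case True
      have "of_nat n \<le> ?S" for n
      proof -
        have "(of_nat n :: ennreal) = (\<Sum>k<n. 1)" by simp
        also have "\<dots> \<le> (\<Sum>k<n. ennreal (2 ^ k) * indicator (L k) z)"
          using True by (intro sum_mono) (auto simp: ennreal_ge_1)
        also have "\<dots> \<le> ?S" by (intro sum_le_suminf) auto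
        finally show ?thesis .
      qed
      then have "?S = \<infinity>" by (metis ennreal_Ex_less_of_nat infinity_ennreal_def leD less_top)
      then show ?thesis using \<open>C > 0\<close> by (simp add: ennreal_mult_top z)
    next
      case False
      define k where "k = (LEAST k. z \<notin> L k)"
      have k: "z \<notin> L k" unfolding k_def using False by (metis LeastI)
      then have Gk: "\<tau> k \<le> G z" using z by (auto simp: L_def)
      then have pos: "G z > 0" using \<tau>[of k] by linarith
      have "G z powr (- \<epsilon>) \<le> \<tau> k powr (- \<epsilon>)"
        using Gk \<tau>[of k] \<open>\<epsilon> > 0\<close> by (intro powr_mono2') auto
      also note \<tau>_powr
      finally have G: "G z powr (- \<epsilon>) \<le> c powr (- \<epsilon>) * (2 * 2 ^ k)" .
      have "ennreal (G z powr (- \<epsilon>)) \<le> ennreal C * (1 + ?S)"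
      proof (cases k)
        case 0
        have "c powr (- \<epsilon>) * (2 * 2 ^ k) \<le> C" by (simp add: 0 C_def)
        then have "G z powr (- \<epsilon>) \<le> C" using G by linarith
        then have "ennreal (G z powr (- \<epsilon>)) \<le> ennreal C * 1" by (simp add: ennreal_leI)
        also have "\<dots> \<le> ennreal C * (1 + ?S)" by (intro mult_left_mono) auto
        finally show ?thesis .
      next
        case (Suc j)
        then have "z \<in> L j" using not_less_Least[of j "\<lambda>k. z \<notin> L k"] by (auto simp: k_def)
        have "(\<Sum>i\<in>{j}. ennreal (2 ^ i) * indicator (L i) z) \<le> ?S" by (intro sum_le_suminf) auto
        then have "ennreal (2 ^ j) \<le> ?S" using \<open>z \<in> L j\<close> by simp
        have "ennreal (G z powr (- \<epsilon>)) \<le> ennreal (C * 2 ^ j)"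
          using G by (intro ennreal_leI) (simp add: Suc C_def)
        also have "\<dots> = ennreal C * ennreal (2 ^ j)" using \<open>C > 0\<close> by (simp add: ennreal_mult)
        also have "\<dots> \<le> ennreal C * (1 + ?S)"
          using \<open>ennreal (2 ^ j) \<le> ?S\<close> by (intro mult_left_mono) (auto intro: add_increasing)
        finally show ?thesis .
      qed
      then show ?thesis using pos z by simp
    qed
  qed simp
  have "(\<integral>\<^sup>+z\<in>A. (if G z = 0 then \<infinity> else ennreal (G z powr (- \<epsilon>))) \<partial>M)
    \<le> (\<integral>\<^sup>+z. ennreal C * (indicator A z + (\<Sum>k. ennreal (2 ^ k) * indicator (L k) z)) \<partial>M)"
    by (intro nn_integral_mono bound)
  also have "\<dots> = ennreal C * (emeasure M A + (\<Sum>k. ennreal (2 ^ k) * emeasure M (L k)))"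
    by (simp add: nn_integral_cmult nn_integral_add nn_integral_suminf)
  also have "\<dots> \<le> ennreal C * (emeasure M A + (\<Sum>k. ennreal (K * (1/2) ^ k)))"
  proof (intro mult_left_mono add_left_mono suminf_le summableI)
    fix k
    have "ennreal (2 ^ k) * emeasure M (L k) \<le> ennreal (2 ^ k) * ennreal (K * (1/4) ^ k)"
      by (intro mult_left_mono Lm) auto
    also have "\<dots> = ennreal (K * (1/2) ^ k)"
      using \<open>K \<ge> 0\<close> by (simp flip: ennreal_mult' add: power_divide field_simps flip: power_mult_distrib)
    finally show "ennreal (2 ^ k) * emeasure M (L k) \<le> ennreal (K * (1/2) ^ k)" .
  qed auto
  also have "(\<Sum>k. ennreal (K * (1/2) ^ k)) = ennreal (K * 2)"
    using \<open>K \<ge> 0\<close> geometric_sums[of "1/2::real"] by (intro suminf_ennreal_eq) (auto intro!: sums_mult)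
  also have "ennreal C * (emeasure M A + ennreal (K * 2)) < \<infinity>"
    using fin by (auto simp: ennreal_mult_less_top)
  finally show ?thesis unfolding \<epsilon>_def .
qed

text \<open>The sublevel estimate holds on each line parallel to the nonflat direction; averaging over
  these lines turns it into a volume estimate for \<open>|f|\<close> near the origin, and this into integrability of
  a small negative power.\<close>

lemma holomorphic_negative_power_integrable:
  fixes f :: "complex ^ ('n::finite) \<Rightarrow> complex"
  assumes "holomorphic_near_0 f" and nz: "\<not> eventually (\<lambda>z. f z = 0) (nhds 0)"
  obtains \<eta> \<epsilon> :: real where "\<eta> > 0" "\<epsilon> > 0"
    "(\<integral>\<^sup>+z\<in>ball 0 \<eta>. (if norm (f z) = 0 then \<infinity> else ennreal (norm (f z) powr (- \<epsilon>))) \<partial>lborel) < \<infinity>"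
proof -
  obtain r where "r > 0" and hol: "holomorphic_several f (ball 0 r)"
    using assms(1) unfolding holomorphic_near_0_def
    by (meson holomorphic_several_subset open_contains_ball_eq)
  from hol \<open>r > 0\<close> nz obtain \<rho> c :: real and \<phi> :: "complex ^ 'n \<Rightarrow> nat \<Rightarrow> real \<Rightarrow> real"
    and m :: nat and v :: "complex ^ 'n"
    where "\<rho> > 0" "c > 0"
    and der: "\<And>w k x. norm w < \<rho> \<Longrightarrow> x \<in> {-\<rho>..\<rho>} \<Longrightarrow> (\<phi> w k has_real_derivative \<phi> w (Suc k) x) (at x)"
    and lower: "\<And>w x. norm w < \<rho> \<Longrightarrow> x \<in> {-\<rho>..\<rho>} \<Longrightarrow> c \<le> \<bar>\<phi> w m x\<bar>"
    and le: "\<And>w x. norm w < \<rho> \<Longrightarrow> x \<in> {-\<rho>..\<rho>} \<Longrightarrow> \<bar>\<phi> w 0 x\<bar> \<le> norm (f (w + x *\<^sub>R v))"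
    by (rule holomorphic_nonflat_direction) (rule that; assumption)
  \<comment> \<open>Shifts by at most \<open>\<sigma>\<close> in the direction \<open>v\<close> keep the ball of radius \<open>\<eta>\<close> inside the ball of
    radius \<open>\<rho>\<close>.\<close>
  define \<sigma> where "\<sigma> = min \<rho> (\<rho> / (2 * (norm v + 1)))"
  define \<eta> where "\<eta> = min r (\<rho> / 2)"
  have \<sigma>: "0 < \<sigma>" "\<sigma> \<le> \<rho>" "\<sigma> * norm v \<le> \<rho> / 2"
  proof -
    show "0 < \<sigma>" "\<sigma> \<le> \<rho>" using \<open>\<rho> > 0\<close> by (auto simp: \<sigma>_def add_nonneg_pos)
    have "\<sigma> * norm v \<le> \<rho> / (2 * (norm v + 1)) * norm v"
      by (intro mult_right_mono) (auto simp: \<sigma>_def)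
    also have "\<dots> \<le> \<rho> / 2"
    proof -
      have "norm v / (norm v + 1) \<le> 1" by (simp add: divide_le_eq_1 add_nonneg_pos)
      then have "\<rho> / 2 * (norm v / (norm v + 1)) \<le> \<rho> / 2 * 1"
        using \<open>\<rho> > 0\<close> by (intro mult_left_mono) auto
      then show ?thesis by simp
    qed
    finally show "\<sigma> * norm v \<le> \<rho> / 2" .
  qed
  have \<eta>: "0 < \<eta>" "\<eta> \<le> r" "\<eta> \<le> \<rho> / 2" using \<open>r > 0\<close> \<open>\<rho> > 0\<close> by (auto simp: \<eta>_def)
  have cont: "continuous_on (ball 0 \<eta>) f"
    using \<eta>(2) by (intro continuous_on_subset[OF holomorphic_several_continuous_on[OF hol]]) auto
  let ?W = "ball (0 :: complex ^ 'n) \<rho>"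
  define K where "K = 2 ^ m * 2 * measure lborel ?W / (2 * \<sigma>)"
  have "K \<ge> 0" using \<sigma> by (simp add: K_def)
  have small: "emeasure lborel {z\<in>ball 0 \<eta>. norm (f z) < c * (\<delta>/2) ^ m} \<le> ennreal (K * \<delta>)"
    if "\<delta> > 0" for \<delta>
  proof -
    let ?A = "{z\<in>ball 0 \<eta>. norm (f z) < c * (\<delta>/2) ^ m}"
    have "open ?A"
    proof -
      have "?A = ball 0 \<eta> \<inter> (\<lambda>z. norm (f z)) -` {..<c * (\<delta>/2) ^ m}" by auto
      then show ?thesis
        using continuous_open_preimage[OF continuous_on_norm[OF cont] open_ball open_lessThan] by simp
    qed
    have "?A \<in> fmeasurable lborel"
    proof (rule fmeasurableI)
      have "emeasure lborel ?A \<le> emeasure lborel (ball (0 :: complex ^ 'n) \<eta>)"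
        by (rule emeasure_mono) auto
      also have "\<dots> < \<infinity>" by (rule emeasure_lborel_ball_finite)
      finally show "emeasure lborel ?A < \<infinity>" .
    qed (use \<open>open ?A\<close> in simp)
    have "ennreal (2 * \<sigma>) * emeasure lborel ?A \<le> ennreal (2 ^ m * (2 * \<delta>)) * emeasure lborel ?W"
    proof (rule emeasure_lborel_translation_average[where v = v])
      show "?A \<in> sets borel" using \<open>open ?A\<close> by simp
      show "z - x *\<^sub>R v \<in> ?W" if "z \<in> ?A" "x \<in> {-\<sigma>..\<sigma>}" for z x
      proof -
        have "norm (x *\<^sub>R v) \<le> \<sigma> * norm v"
          using that(2) by (auto intro!: mult_right_mono)
        then show ?thesis
          using norm_triangle_ineq4[of z "x *\<^sub>R v"] that(1) \<sigma>(3) \<eta>(3) by auto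
      qed
      fix w assume "w \<in> ?W"
      then have w: "norm w < \<rho>" by simp
      show "emeasure lborel {x \<in> {-\<sigma>..\<sigma>}. w + x *\<^sub>R v \<in> ?A} \<le> ennreal (2 ^ m * (2 * \<delta>))"
      proof (rule emeasure_sublevel_le[OF der[OF w] lower[OF w] \<open>\<delta> > 0\<close>])
        show "{x \<in> {-\<sigma>..\<sigma>}. w + x *\<^sub>R v \<in> ?A} \<subseteq> {-\<rho>..\<rho>}" using \<sigma>(2) by auto
        show "\<bar>\<phi> w 0 x\<bar> < c * (\<delta> / 2) ^ m" if "x \<in> {x \<in> {-\<sigma>..\<sigma>}. w + x *\<^sub>R v \<in> ?A}" for x
          using le[OF w, of x] that \<sigma>(2) by auto
      qed
    qed (use \<sigma> in auto)
    moreover have "emeasure lborel ?A = ennreal (measure lborel ?A)"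
      using \<open>?A \<in> fmeasurable lborel\<close> by (simp add: emeasure_eq_measure2)
    moreover have "emeasure lborel ?W = ennreal (measure lborel ?W)"
      using emeasure_lborel_ball_finite[of "0 :: complex ^ 'n" \<rho>]
      by (intro emeasure_eq_ennreal_measure) (simp add: less_top)
    ultimately have "ennreal (2 * \<sigma> * measure lborel ?A) \<le> ennreal (2 ^ m * (2 * \<delta>) * measure lborel ?W)"
      using \<sigma> \<open>\<delta> > 0\<close> by (simp add: ennreal_mult)
    then have "2 * \<sigma> * measure lborel ?A \<le> 2 ^ m * (2 * \<delta>) * measure lborel ?W"
      using \<open>\<delta> > 0\<close> by (simp add: ennreal_le_iff)
    then have "measure lborel ?A \<le> K * \<delta>"
      using \<sigma> by (simp add: K_def field_simps)
    then show ?thesis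
      using \<open>emeasure lborel ?A = _\<close> by (simp add: ennreal_leI)
  qed
  show ?thesis
  proof (rule that)
    show "\<eta> > 0" by fact
    show "1 / (2 * real (Suc m)) > 0" by simp
    show "(\<integral>\<^sup>+z\<in>ball 0 \<eta>. (if norm (f z) = 0 then \<infinity> else ennreal (norm (f z) powr (- (1 / (2 * real (Suc m)))))) \<partial>lborel) < \<infinity>"
    proof (rule nn_integral_negative_power_finite[OF _ _ _ \<open>c > 0\<close> \<open>K \<ge> 0\<close> small])
      show "(\<lambda>z. norm (f z)) \<in> borel_measurable (restrict_space lborel (ball 0 \<eta>))"
        using borel_measurable_continuous_on_restrict[OF continuous_on_norm[OF cont]]
        by (simp add: measurable_cong_sets[OF sets_restrict_space_cong[OF sets_lborel] refl])
    qed (use emeasure_lborel_ball_finite[of "0 :: complex ^ 'n" \<eta>] in auto)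
  qed
qed

section \<open>Local integrability and the absolute value of an ideal\<close>

lemma exp_ereal_simps [simp]:
  "exp_ereal (ereal r) = ennreal (exp r)" "exp_ereal \<infinity> = \<infinity>" "exp_ereal (-\<infinity>) = 0" "exp_ereal 0 = 1"
  using ereal.simps by (auto simp: exp_ereal_def zero_ereal_def)

lemma borel_measurable_exp_ereal [measurable]: "exp_ereal \<in> borel_measurable borel"
proof -
  have "exp_ereal = (\<lambda>x. if x = \<infinity> then \<infinity> else if x = -\<infinity> then 0 else ennreal (exp (real_of_ereal x)))"
  proof
    show "exp_ereal x = (if x = \<infinity> then \<infinity> else if x = -\<infinity> then 0 else ennreal (exp (real_of_ereal x)))" for x
      by (cases x) auto
  qed
  then show ?thesis by (subst \<open>exp_ereal = _\<close>) measurable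
qed

lemma integrable_near_0_dominated:
  assumes V: "open V" "0 \<in> V" and meas: "g \<in> borel_measurable (restrict_space borel V)"
    and le: "\<And>z. z \<in> V \<Longrightarrow> g z \<le> h z" and h: "integrable_near_0 h"
  shows "integrable_near_0 g"
proof -
  obtain U where U: "open U" "0 \<in> U" "(\<lambda>z. h z * indicator U z) \<in> borel_measurable lborel"
    "(\<integral>\<^sup>+z\<in>U. h z \<partial>lborel) < \<infinity>"
    using h unfolding integrable_near_0_def by blast
  let ?W = "V \<inter> U"
  have "(\<lambda>z. g z * indicator V z) \<in> borel_measurable lborel"
    using meas V by (subst (asm) borel_measurable_restrict_space_iff_ennreal) auto
  then have "(\<lambda>z. (g z * indicator V z) * indicator U z) \<in> borel_measurable lborel"
    by (rule borel_measurable_times_ennreal) (use U(1) in \<open>intro borel_measurable_indicator, simp\<close>)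
  then have "(\<lambda>z. g z * indicator ?W z) \<in> borel_measurable lborel"
    by (simp add: indicator_inter_arith mult.assoc)
  moreover have "(\<integral>\<^sup>+z\<in>?W. g z \<partial>lborel) \<le> (\<integral>\<^sup>+z\<in>U. h z \<partial>lborel)"
    using le by (intro nn_integral_mono) (auto simp: indicator_def)
  ultimately show ?thesis
    using U V unfolding integrable_near_0_def by (intro exI[of _ ?W]) auto
qed

lemma integrable_near_0_add:
  assumes "integrable_near_0 g" and "integrable_near_0 h"
  shows "integrable_near_0 (\<lambda>z. g z + h z)"
proof -
  obtain U where U: "open U" "0 \<in> U" and gm: "(\<lambda>z. g z * indicator U z) \<in> borel_measurable lborel"
    and gi: "(\<integral>\<^sup>+z\<in>U. g z \<partial>lborel) < \<infinity>"
    using assms(1) unfolding integrable_near_0_def by blast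
  obtain V where V: "open V" "0 \<in> V" and hm: "(\<lambda>z. h z * indicator V z) \<in> borel_measurable lborel"
    and hi: "(\<integral>\<^sup>+z\<in>V. h z \<partial>lborel) < \<infinity>"
    using assms(2) unfolding integrable_near_0_def by blast
  let ?F = "\<lambda>z. g z * indicator U z + h z * indicator V z"
  have "(\<lambda>z. ?F z * indicator (U \<inter> V) z) \<in> borel_measurable lborel"
    using U(1) V(1) by (intro borel_measurable_times_ennreal borel_measurable_add[OF gm hm] borel_measurable_indicator) simp
  moreover have "(\<lambda>z. ?F z * indicator (U \<inter> V) z) = (\<lambda>z. (g z + h z) * indicator (U \<inter> V) z)"
    by (auto simp: indicator_def)
  moreover have "(\<integral>\<^sup>+z\<in>U \<inter> V. (g z + h z) \<partial>lborel) \<le> (\<integral>\<^sup>+z. ?F z \<partial>lborel)"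
    by (intro nn_integral_mono) (auto simp: indicator_def)
  moreover have "(\<integral>\<^sup>+z. ?F z \<partial>lborel) < \<infinity>"
    using gi hi by (simp add: nn_integral_add[OF gm hm])
  ultimately show ?thesis
    using U V unfolding integrable_near_0_def by (intro exI[of _ "U \<inter> V"]) (auto intro: le_less_trans)
qed

lemma integrable_near_0_bounded_mult:
  fixes p :: "complex ^ 'n::finite \<Rightarrow> ennreal"
  assumes V: "open V" "0 \<in> V" and meas: "p \<in> borel_measurable (restrict_space borel V)"
    and le: "\<And>z. z \<in> V \<Longrightarrow> p z \<le> ennreal C" and g: "integrable_near_0 g"
  shows "integrable_near_0 (\<lambda>z. p z * g z)"
proof -
  obtain U where U: "open U" "0 \<in> U" and gm: "(\<lambda>z. g z * indicator U z) \<in> borel_measurable lborel"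
    and gi: "(\<integral>\<^sup>+z\<in>U. g z \<partial>lborel) < \<infinity>"
    using g unfolding integrable_near_0_def by blast
  have "(\<lambda>z. p z * indicator V z) \<in> borel_measurable lborel"
    using meas V by (subst (asm) borel_measurable_restrict_space_iff_ennreal) auto
  then have "(\<lambda>z. (p z * indicator V z) * (g z * indicator U z)) \<in> borel_measurable lborel"
    using gm by (rule borel_measurable_times_ennreal)
  moreover have "(\<lambda>z. (p z * indicator V z) * (g z * indicator U z)) = (\<lambda>z. (p z * g z) * indicator (V \<inter> U) z)"
    by (auto simp: indicator_def)
  moreover have "(\<integral>\<^sup>+z\<in>V \<inter> U. (p z * g z) \<partial>lborel) \<le> (\<integral>\<^sup>+z. ennreal C * (g z * indicator U z) \<partial>lborel)"
    using le by (intro nn_integral_mono) (auto simp: indicator_def intro: mult_right_mono)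
  moreover have "(\<integral>\<^sup>+z. ennreal C * (g z * indicator U z) \<partial>lborel) < \<infinity>"
    using gi by (simp add: nn_integral_cmult[OF gm] ennreal_mult_less_top)
  ultimately show ?thesis
    using U V unfolding integrable_near_0_def by (intro exI[of _ "V \<inter> U"]) (auto intro: le_less_trans)
qed

lemma generates_ideal_ideal_abs:
  assumes "coherent_ideal J"
  obtains F where "generates_ideal F J" "ideal_abs J = gen_abs F"
proof -
  have "generates_ideal (SOME F. generates_ideal F J) J"
    using assms unfolding coherent_ideal_def by (metis someI_ex)
  then show ?thesis by (rule that) (simp add: ideal_abs_def)
qed

lemma continuous_on_ideal_abs:
  assumes "coherent_ideal J"
  obtains V where "open V" "0 \<in> V" "continuous_on V (ideal_abs J)"
proof -
  obtain F where F: "generates_ideal F J" "ideal_abs J = gen_abs F"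
    using assms by (rule generates_ideal_ideal_abs)
  then have "\<forall>f\<in>F. \<exists>U. open U \<and> 0 \<in> U \<and> continuous_on U f"
    unfolding generates_ideal_def holomorphic_near_0_def holomorphic_several_def
    by (metis has_derivative_continuous continuous_at_imp_continuous_on)
  then obtain U where U: "\<And>f. f \<in> F \<Longrightarrow> open (U f) \<and> 0 \<in> U f \<and> continuous_on (U f) f" by metis
  have "continuous_on (\<Inter>f\<in>F. U f) (\<lambda>z. norm (f z))" if "f \<in> F" for f
    using U[OF that] that by (blast intro: continuous_on_norm continuous_on_subset)
  then have "continuous_on (\<Inter>f\<in>F. U f) (gen_abs F)"
    unfolding gen_abs_def[abs_def] by (intro continuous_on_sum)
  moreover have "open (\<Inter>f\<in>F. U f)" "0 \<in> (\<Inter>f\<in>F. U f)"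
    using U F(1) unfolding generates_ideal_def by auto
  ultimately show ?thesis using that F(2) by metis
qed

lemma ideal_abs_nonneg:
  assumes "coherent_ideal J"
  shows "0 \<le> ideal_abs J z"
  using generates_ideal_ideal_abs[OF assms] gen_abs_nonneg by metis

lemma ideal_abs_UNIV_comparable_one:
  obtains M where "M > 0"
    "eventually (\<lambda>z::complex ^ 'n::finite. 1 \<le> M * ideal_abs UNIV z \<and> ideal_abs UNIV z \<le> M) (nhds 0)"
proof -
  have 1: "abs_germ (\<lambda>_::complex^'n. 1) = 1" by (simp add: one_germ_def)
  have "x \<in> germ.span {1}" for x :: "'n germ"
    using germ.span_scale[OF germ.span_base[of 1 "{1}"], of x] by simp
  then have G: "generates_ideal {\<lambda>_. 1} (UNIV :: 'n germ set)"
    by (auto simp: generates_ideal_def 1)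
  obtain F where F: "generates_ideal F (UNIV :: 'n germ set)" "ideal_abs (UNIV :: 'n germ set) = gen_abs F"
    using coherent_ideal_UNIV by (rule generates_ideal_ideal_abs)
  obtain A B where A: "A > 0" "eventually (\<lambda>z. gen_abs {\<lambda>_. 1} z \<le> A * gen_abs F z) (nhds 0)"
    and B: "B > 0" "eventually (\<lambda>z. gen_abs F z \<le> B * gen_abs {\<lambda>_. 1} z) (nhds 0)"
    using gen_abs_comparable[OF F(1) G] gen_abs_comparable[OF G F(1)] by blast
  have "eventually (\<lambda>z. 1 \<le> max A B * ideal_abs UNIV z \<and> ideal_abs UNIV z \<le> max A B) (nhds (0::complex^'n))"
    using A(2) B(2)
  proof eventually_elim
    case (elim z)
    have "A * gen_abs F z \<le> max A B * gen_abs F z" by (intro mult_right_mono gen_abs_nonneg) auto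
    then show ?case using elim by (auto simp: F(2) gen_abs_def[of "{\<lambda>_. 1}"])
  qed
  with A(1) show ?thesis by (intro that[of "max A B"]) auto
qed

text \<open>The factor \<open>|\<O>|\<^sup>2\<close> for the unit ideal is bounded above and away from zero near the origin,
  so it does not affect integrability.\<close>

lemma singularity_exponent_eq:
  "singularity_exponent u = Sup (ereal ` {c. 0 \<le> c \<and> integrable_near_0 (\<lambda>z. exp_ereal (ereal (- 2 * c) * u z))})"
proof -
  let ?i = "ideal_abs (UNIV :: 'a germ set)"
  have "integrable_near_0 (\<lambda>z. ennreal ((?i z)\<^sup>2) * g z) \<longleftrightarrow> integrable_near_0 g" for g
  proof -
    obtain M where "M > 0" and "eventually (\<lambda>z. 1 \<le> M * ?i z \<and> ?i z \<le> M) (nhds 0)"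
      by (rule ideal_abs_UNIV_comparable_one)
    then obtain W where W: "open W" "0 \<in> W" "\<And>z. z \<in> W \<Longrightarrow> 1 \<le> M * ?i z \<and> ?i z \<le> M"
      unfolding eventually_nhds by blast
    obtain V where V: "open V" "0 \<in> V" "continuous_on V ?i"
      using continuous_on_ideal_abs[OF coherent_ideal_UNIV] by blast
    have VW: "open (V \<inter> W)" "0 \<in> V \<inter> W" using V W by auto
    have "continuous_on (V \<inter> W) ?i" using V(3) by (rule continuous_on_subset) auto
    then have m: "?i \<in> borel_measurable (restrict_space borel (V \<inter> W))"
      by (rule borel_measurable_continuous_on_restrict)
    have pos: "?i z > 0" if "z \<in> W" for z
      using W(3)[OF that] \<open>M > 0\<close> by (metis less_le_trans zero_less_mult_pos zero_less_one)
    show ?thesis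
    proof
      assume g: "integrable_near_0 g"
      show "integrable_near_0 (\<lambda>z. ennreal ((?i z)\<^sup>2) * g z)"
      proof (rule integrable_near_0_bounded_mult[OF VW _ _ g])
        show "(\<lambda>z. ennreal ((?i z)\<^sup>2)) \<in> borel_measurable (restrict_space borel (V \<inter> W))"
          using m by measurable
        show "ennreal ((?i z)\<^sup>2) \<le> ennreal (M\<^sup>2)" if "z \<in> V \<inter> W" for z
          using W(3)[of z] pos[of z] that by (intro ennreal_leI power_mono) auto
      qed
    next
      assume ig: "integrable_near_0 (\<lambda>z. ennreal ((?i z)\<^sup>2) * g z)"
      have "integrable_near_0 (\<lambda>z. ennreal (inverse ((?i z)\<^sup>2)) * (ennreal ((?i z)\<^sup>2) * g z))"
      proof (rule integrable_near_0_bounded_mult[OF VW _ _ ig])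
        show "(\<lambda>z. ennreal (inverse ((?i z)\<^sup>2))) \<in> borel_measurable (restrict_space borel (V \<inter> W))"
          using m by measurable
        show "ennreal (inverse ((?i z)\<^sup>2)) \<le> ennreal (M\<^sup>2)" if "z \<in> V \<inter> W" for z
        proof -
          have "inverse (?i z) \<le> M" using W(3)[of z] pos[of z] that by (simp add: field_simps)
          then have "(inverse (?i z))\<^sup>2 \<le> M\<^sup>2" using pos[of z] that by (intro power_mono) auto
          then show ?thesis by (intro ennreal_leI) (simp add: power_inverse)
        qed
      qed
      moreover have inv: "ennreal (inverse ((?i z)\<^sup>2)) * (ennreal ((?i z)\<^sup>2) * g z) = g z" if "z \<in> V \<inter> W" for z
      proof -
        have "ennreal (inverse ((?i z)\<^sup>2)) * ennreal ((?i z)\<^sup>2) = 1"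
          using pos[of z] that by (simp flip: ennreal_mult)
        then show ?thesis by (metis mult.assoc mult_1)
      qed
      ultimately obtain U where U: "open U" "0 \<in> U"
        "(\<lambda>z. (ennreal (inverse ((?i z)\<^sup>2)) * (ennreal ((?i z)\<^sup>2) * g z)) * indicator U z) \<in> borel_measurable lborel"
        "(\<integral>\<^sup>+z\<in>U. (ennreal (inverse ((?i z)\<^sup>2)) * (ennreal ((?i z)\<^sup>2) * g z)) \<partial>lborel) < \<infinity>"
        unfolding integrable_near_0_def by blast
      let ?h = "\<lambda>z. (ennreal (inverse ((?i z)\<^sup>2)) * (ennreal ((?i z)\<^sup>2) * g z)) * indicator U z"
      have eq: "(\<lambda>z. g z * indicator (U \<inter> (V \<inter> W)) z) = (\<lambda>z. ?h z * indicator (V \<inter> W) z)"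
        using inv by (auto simp: fun_eq_iff indicator_def)
      have "(\<lambda>z. g z * indicator (U \<inter> (V \<inter> W)) z) \<in> borel_measurable lborel"
        unfolding eq by (intro borel_measurable_times_ennreal[OF U(3)] borel_measurable_indicator) (use VW(1) in simp)
      moreover have "(\<integral>\<^sup>+z\<in>U \<inter> (V \<inter> W). g z \<partial>lborel) \<le> (\<integral>\<^sup>+z. ?h z \<partial>lborel)"
        unfolding eq by (intro nn_integral_mono) (auto simp: indicator_def)
      ultimately show "integrable_near_0 g"
        using U(1,2,4) VW unfolding integrable_near_0_def
        by (intro exI[of _ "U \<inter> (V \<inter> W)"]) (auto intro: le_less_trans)
    qed
  qed
  then show ?thesis by (simp add: singularity_exponent_def jumping_number_def)
qed

text \<open>Since \<open>J\<close> is nonzero, some generator \<open>f\<close> has a nonzero germ, and \<open>|f| \<le> |J|\<close> reduces the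
  claim to a negative power of \<open>|f|\<close>. The lemma excludes the degenerate right-hand side \<open>0 / 0 = 0\<close> in
  the final estimate.\<close>

lemma log_ideal_abs_exponent_pos:
  fixes J :: "('n::finite) germ set"
  assumes J: "coherent_ideal J" and nz: "J \<noteq> {0}"
  shows "\<exists>b>0. integrable_near_0 (\<lambda>z. exp_ereal (ereal (- 2 * b) * log_ideal_abs J z))"
proof -
  obtain F where F: "generates_ideal F J" "ideal_abs J = gen_abs F"
    using J by (rule generates_ideal_ideal_abs)
  then have fin: "finite F" and hol: "\<And>f. f \<in> F \<Longrightarrow> holomorphic_near_0 f"
    and span: "J = germ.span (abs_germ ` F)"
    by (auto simp: generates_ideal_def)
  have "\<exists>f\<in>F. abs_germ f \<noteq> 0"
  proof (rule ccontr)
    assume "\<not> ?thesis"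
    then have "abs_germ ` F \<subseteq> {0}" by auto
    then have "J \<subseteq> germ.span {0}" unfolding span by (rule germ.span_mono)
    moreover have "germ.span {0 :: 'n germ} = {0}" by simp
    moreover have "0 \<in> J" unfolding span by (rule germ.span_zero)
    ultimately show False using nz by auto
  qed
  then obtain f where f: "f \<in> F" "abs_germ f \<noteq> 0" by blast
  have "\<not> eventually (\<lambda>z. f z = 0) (nhds 0)"
    using f abs_germ_eq[OF hol[OF f(1)] holomorphic_near_0_const[of 0]] by (simp add: zero_germ_def)
  then obtain \<eta> \<epsilon> where \<eta>: "\<eta> > 0" and \<epsilon>: "\<epsilon> > 0"
    and int: "(\<integral>\<^sup>+z\<in>ball 0 \<eta>. (if norm (f z) = 0 then \<infinity> else ennreal (norm (f z) powr (- \<epsilon>))) \<partial>lborel) < \<infinity>"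
    by (rule holomorphic_negative_power_integrable[OF hol[OF f(1)]])
  obtain V where V: "open V" "0 \<in> V" "continuous_on V (ideal_abs J)"
    using continuous_on_ideal_abs[OF J] by blast
  let ?W = "V \<inter> ball 0 \<eta>"
  let ?g = "\<lambda>z. exp_ereal (ereal (- 2 * (\<epsilon> / 2)) * log_ideal_abs J z)"
  have W: "open ?W" "0 \<in> ?W" using V \<eta> by auto
  have "continuous_on ?W (ideal_abs J)" using V(3) by (rule continuous_on_subset) auto
  then have [measurable]: "ideal_abs J \<in> borel_measurable (restrict_space borel ?W)"
    by (rule borel_measurable_continuous_on_restrict)
  have "?g \<in> borel_measurable (restrict_space borel ?W)"
    unfolding log_ideal_abs_def[abs_def] by measurable
  then have "(\<lambda>z. ?g z * indicator ?W z) \<in> borel_measurable lborel"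
    using W by (subst (asm) borel_measurable_restrict_space_iff_ennreal) auto
  moreover have "(\<integral>\<^sup>+z\<in>?W. ?g z \<partial>lborel)
    \<le> (\<integral>\<^sup>+z\<in>ball 0 \<eta>. (if norm (f z) = 0 then \<infinity> else ennreal (norm (f z) powr (- \<epsilon>))) \<partial>lborel)"
  proof (intro nn_integral_mono mult_mono)
    fix z
    have le: "norm (f z) \<le> ideal_abs J z"
      unfolding F(2) gen_abs_def using f(1) fin by (intro member_le_sum) auto
    show "?g z \<le> (if norm (f z) = 0 then \<infinity> else ennreal (norm (f z) powr (- \<epsilon>)))"
    proof (cases "norm (f z) = 0")
      case False
      then have pos: "norm (f z) > 0" by simp
      have pos': "ideal_abs J z > 0" using pos le by linarith
      have "?g z = ennreal (ideal_abs J z powr (- \<epsilon>))"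
        using pos' by (simp add: log_ideal_abs_def powr_def)
      also have "\<dots> \<le> ennreal (norm (f z) powr (- \<epsilon>))"
        using pos le \<epsilon> by (intro ennreal_leI powr_mono2') auto
      finally show ?thesis using False by simp
    qed simp
  qed (auto simp: indicator_def)
  ultimately have "integrable_near_0 ?g"
    using W int unfolding integrable_near_0_def by (intro exI[of _ ?W]) (auto intro: le_less_trans)
  then show ?thesis using \<epsilon> by (intro exI[of _ "\<epsilon> / 2"]) auto
qed

section \<open>Comparison of jumping numbers\<close>

text \<open>Write \<open>l = ln g\<close>. With \<open>a = cb/(1+b)\<close>, the exponent \<open>-2ax\<close> is the convex combination of
  \<open>2l - 2cx\<close> and \<open>-2bl\<close> with weights \<open>b/(1+b)\<close> and \<open>1/(1+b)\<close>, in which \<open>l\<close> cancels; so it is at most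
  their maximum. This is the pointwise form of Hoelder's inequality with exponents \<open>1 + 1/b\<close> and
  \<open>1 + b\<close>. The last summand is infinite where \<open>g = 0\<close>.\<close>

lemma exp_weight_le_sum:
  fixes g b c :: real and x L :: ereal
  assumes "g \<ge> 0" "b > 0" "c \<ge> 0" "x < \<infinity>"
    and L: "L = (if g = 0 then -\<infinity> else ereal (ln g))"
  shows "exp_ereal (ereal (- 2 * (c * b / (1 + b))) * x)
    \<le> ennreal (g\<^sup>2) * exp_ereal (ereal (- 2 * c) * x) + exp_ereal (ereal (- 2 * b) * L)"
proof (cases "g = 0")
  case True
  then have "exp_ereal (ereal (- 2 * b) * L) = \<infinity>" using \<open>b > 0\<close> by (simp add: L)
  then show ?thesis by simp
next
  case False
  with \<open>g \<ge> 0\<close> have "g > 0" by simp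
  define l where "l = ln g"
  have g2: "g\<^sup>2 = exp (2 * l)" using \<open>g > 0\<close> by (simp add: l_def exp_double power2_eq_square)
  have Lr: "L = ereal l" using False by (simp add: L l_def)
  show ?thesis
  proof (cases x)
    case (real r)
    define s where "s = - 2 * (c * b / (1 + b)) * r"
    have "s \<le> max (2 * l - 2 * c * r) (- 2 * b * l)"
    proof -
      have "(1 + b) * s = b * (2 * l - 2 * c * r) + (- 2 * b * l)"
        using \<open>b > 0\<close> by (simp add: s_def field_simps)
      also have "\<dots> \<le> b * max (2 * l - 2 * c * r) (- 2 * b * l) + max (2 * l - 2 * c * r) (- 2 * b * l)"
        using \<open>b > 0\<close> by (intro add_mono mult_left_mono) auto
      also have "\<dots> = (1 + b) * max (2 * l - 2 * c * r) (- 2 * b * l)" by (simp add: algebra_simps)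
      finally show ?thesis using \<open>b > 0\<close> by simp
    qed
    then have "exp s \<le> exp (2 * l - 2 * c * r) + exp (- 2 * b * l)"
      by (cases "2 * l - 2 * c * r \<le> - 2 * b * l") (auto simp: max_def intro: add_increasing add_increasing2)
    then have "ennreal (exp s) \<le> ennreal (g\<^sup>2 * exp (- 2 * c * r) + exp (- 2 * b * l))"
      by (intro ennreal_leI) (simp add: g2 flip: exp_add)
    then show ?thesis
      by (simp add: real Lr s_def ennreal_mult)
  next
    case PInf
    with \<open>x < \<infinity>\<close> show ?thesis by simp
  next
    case MInf
    show ?thesis
    proof (cases "c = 0")
      case True
      have "1 \<le> exp (2 * l) + exp (- 2 * b * l)"
      proof (cases "l \<ge> 0")
        case True
        then have "1 \<le> exp (2 * l)" by simp
        then show ?thesis by (simp add: add_increasing2)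
      next
        case False
        then have "1 \<le> exp (- 2 * b * l)" using \<open>b > 0\<close> by (simp add: mult_nonneg_nonpos)
        then show ?thesis by (simp add: add_increasing)
      qed
      then have "ennreal 1 \<le> ennreal (g\<^sup>2 + exp (- 2 * b * l))" by (intro ennreal_leI) (simp add: g2)
      then show ?thesis by (simp add: True Lr MInf flip: zero_ereal_def)
    next
      case False
      then have "c > 0" using \<open>c \<ge> 0\<close> by simp
      then have "exp_ereal (ereal (- 2 * c) * x) = \<infinity>" by (simp add: MInf)
      then show ?thesis using \<open>g > 0\<close> by (simp add: ennreal_mult_top)
    qed
  qed
qed

text \<open>Upper semicontinuity is defined by real levels; the sublevel set of a level \<open>y\<close> in the extended
  reals is a union of sublevel sets of real ones.\<close>

lemma plurisubharmonic_on_borel_measurable: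
  assumes "plurisubharmonic_on u U"
  shows "u \<in> borel_measurable (restrict_space borel U)"
proof -
  have op: "open {z\<in>U. u z < ereal c}" for c
    using assms by (simp add: plurisubharmonic_on_def)
  have "open {z\<in>U. u z < y}" for y
  proof -
    have "{z\<in>U. u z < y} = (\<Union>c\<in>{c. ereal c < y}. {z\<in>U. u z < ereal c})"
    proof (intro equalityI subsetI)
      fix z assume "z \<in> {z\<in>U. u z < y}"
      moreover from this obtain c where "u z < ereal c" "ereal c < y" using ereal_dense2 by blast
      ultimately show "z \<in> (\<Union>c\<in>{c. ereal c < y}. {z\<in>U. u z < ereal c})" by blast
    next
      fix z assume "z \<in> (\<Union>c\<in>{c. ereal c < y}. {z\<in>U. u z < ereal c})"
      then show "z \<in> {z\<in>U. u z < y}" by (auto intro: less_trans)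
    qed
    then show ?thesis using op by auto
  qed
  moreover have "{z \<in> space (restrict_space borel U). u z < y} = U \<inter> {z\<in>U. u z < y}" for y
    by (auto simp: space_restrict_space)
  ultimately show ?thesis
    by (intro borel_measurableI_less) (auto simp: sets_restrict_space)
qed

text \<open>The pointwise bound \<open>exp_weight_le_sum\<close> dominates the weight near the origin. The conclusion
  reads \<open>c\<^sub>o(u) \<ge> cb/(1+b)\<close>, that is, \<open>c \<le> c\<^sub>o(u)/b + c\<^sub>o(u)\<close>: the theorem up to a limit in \<open>b\<close>
  and \<open>c\<close>.\<close>

lemma integrable_exp_weight:
  fixes u :: "complex ^ ('n::finite) \<Rightarrow> ereal"
  assumes u: "plurisubharmonic_near_0 u" and J: "coherent_ideal J" and "b > 0" "c \<ge> 0"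
    and c: "integrable_near_0 (\<lambda>z. ennreal ((ideal_abs J z)\<^sup>2) * exp_ereal (ereal (- 2 * c) * u z))"
    and b: "integrable_near_0 (\<lambda>z. exp_ereal (ereal (- 2 * b) * log_ideal_abs J z))"
  shows "integrable_near_0 (\<lambda>z. exp_ereal (ereal (- 2 * (c * b / (1 + b))) * u z))"
proof -
  obtain U where U: "open U" "0 \<in> U" "plurisubharmonic_on u U"
    using u unfolding plurisubharmonic_near_0_def by blast
  have [measurable]: "u \<in> borel_measurable (restrict_space borel U)"
    by (rule plurisubharmonic_on_borel_measurable[OF U(3)])
  show ?thesis
  proof (rule integrable_near_0_dominated[OF U(1,2) _ _ integrable_near_0_add[OF c b]])
    show "(\<lambda>z. exp_ereal (ereal (- 2 * (c * b / (1 + b))) * u z)) \<in> borel_measurable (restrict_space borel U)"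
      by measurable
    fix z assume "z \<in> U"
    then have "u z < \<infinity>" using U(3) by (auto simp: plurisubharmonic_on_def)
    then show "exp_ereal (ereal (- 2 * (c * b / (1 + b))) * u z)
      \<le> ennreal ((ideal_abs J z)\<^sup>2) * exp_ereal (ereal (- 2 * c) * u z)
        + exp_ereal (ereal (- 2 * b) * log_ideal_abs J z)"
      using ideal_abs_nonneg[OF J] \<open>b > 0\<close> \<open>c \<ge> 0\<close>
      by (intro exp_weight_le_sum) (auto simp: log_ideal_abs_def)
  qed
qed

theorem corollary2p2:
  fixes u :: "complex ^ ('n::finite) \<Rightarrow> ereal" and J :: "'n germ set"
  assumes "plurisubharmonic_near_0 u"
    and "coherent_ideal J"
    and "J \<noteq> {0}"
  shows "jumping_number J u
           \<le> singularity_exponent u / singularity_exponent (log_ideal_abs J) + singularity_exponent u"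
proof -
  define S where "S = singularity_exponent u"
  define B where "B = singularity_exponent (log_ideal_abs J)"
  let ?b = "\<lambda>b. 0 \<le> b \<and> integrable_near_0 (\<lambda>z. exp_ereal (ereal (- 2 * b) * log_ideal_abs J z))"
  have B: "B = Sup (ereal ` {b. ?b b})" unfolding B_def by (rule singularity_exponent_eq)
  obtain b\<^sub>0 where b\<^sub>0: "b\<^sub>0 > 0" "?b b\<^sub>0"
    using log_ideal_abs_exponent_pos[OF assms(2,3)] by auto
  have "ereal b\<^sub>0 \<le> B" unfolding B using b\<^sub>0(2) by (intro Sup_upper) auto
  then have "B > 0" using b\<^sub>0(1) by (metis ereal_less(2) less_le_trans)
  have "ereal c \<le> S / B + S"
    if "c \<ge> 0" and c: "integrable_near_0 (\<lambda>z. ennreal ((ideal_abs J z)\<^sup>2) * exp_ereal (ereal (- 2 * c) * u z))" for c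
  proof -
    have S: "ereal (c * b / (1 + b)) \<le> S" if "b > 0" "?b b" for b
      unfolding S_def singularity_exponent_eq
      using integrable_exp_weight[OF assms(1,2) that(1) \<open>c \<ge> 0\<close> c] that \<open>c \<ge> 0\<close>
      by (intro Sup_upper) auto
    have "0 \<le> ereal (c * b\<^sub>0 / (1 + b\<^sub>0))" using b\<^sub>0(1) \<open>c \<ge> 0\<close> by simp
    also note S[OF b\<^sub>0]
    finally have "S \<ge> 0" .
    show ?thesis
    proof (cases S)
      case (real s)
      then have "s \<ge> 0" using \<open>S \<ge> 0\<close> by simp
      show ?thesis
      proof (rule ccontr)
        assume "\<not> ?thesis"
        then have less: "S / B + S < ereal c" by simp
        \<comment> \<open>The condition \<open>s < b (c - s)\<close> is the one that contradicts \<open>c b / (1 + b) \<le> s\<close>.\<close>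
        have lessB: "s < c \<and> ereal (s / (c - s)) < B"
        proof (cases B)
          case (real \<beta>)
          then have \<beta>: "\<beta> > 0" using \<open>B > 0\<close> by simp
          have *: "s / \<beta> + s < c" using less \<beta> by (simp add: \<open>S = ereal s\<close> real)
          moreover have "0 \<le> s / \<beta>" using \<open>s \<ge> 0\<close> \<beta> by simp
          ultimately have "s < c" by linarith
          moreover have "s < \<beta> * (c - s)" using * \<beta> by (simp add: field_simps)
          ultimately show ?thesis by (simp add: real pos_divide_less_eq)
        next
          case PInf
          then show ?thesis using less by (simp add: \<open>S = ereal s\<close>)
        next
          case MInf
          then show ?thesis using \<open>B > 0\<close> by simp
        qed
        then obtain b where b: "?b b" "s / (c - s) < b" unfolding B less_Sup_iff by auto
        have "0 \<le> s / (c - s)" using lessB \<open>s \<ge> 0\<close> by simp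
        then have "b > 0" using b(2) by linarith
        have "c * b / (1 + b) \<le> s" using S[OF \<open>b > 0\<close> b(1)] by (simp add: real)
        then have "c * b \<le> s * (1 + b)" using \<open>b > 0\<close> by (simp add: pos_divide_le_eq)
        moreover have "s < b * (c - s)" using b(2) lessB by (simp add: pos_divide_less_eq)
        ultimately show False by (simp add: algebra_simps)
      qed
    next
      case PInf
      have "S / B \<ge> 0" using \<open>S \<ge> 0\<close> \<open>B > 0\<close> by simp
      then show ?thesis using PInf by (cases "S / B") auto
    next
      case MInf
      then show ?thesis using \<open>S \<ge> 0\<close> by simp
    qed
  qed
  then show ?thesis
    unfolding jumping_number_def S_def[symmetric] B_def[symmetric] by (intro Sup_least) auto
qed

end
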